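(* (i) For every irrational $\alpha\in[0,1)$, $\dim_{\rm H}(\Omega_\alpha(1,1))\le\frac{2}{w(\alpha)+1}$. (ii) Let $\alpha\in[0,1)\setminus\mathbb{Q}$ satisfy $\liminf_{k\to\infty}\frac{\log q_{k+1}}{\log q_k}>1$, where $q_k=q_k(\alpha)$ is the denominator of the $k$-th convergent of the continued fraction expansion of $\alpha$. Then $\dim_{\rm H}(\Omega_\alpha(1,1))=\frac{1}{w(\alpha)+1}$.
   Context: For $x\in\mathbb{R}$, $\langle x\rangle$ denotes the distance from $x$ to the nearest integer. "Decreasing" means non-increasing. $\mathcal{D}$ is the set of decreasing functions $\psi:\mathbb{N}\to[0,\infty)$ with $\sum_{q\ge1}\psi(q)=\infty$. For $\psi:\mathbb{N}\to[0,\infty)$, $W_{1,1}(\psi)$ is the set of $(\alpha,\gamma)\in[0,1)^2$ such that $\langle q\alpha-\gamma\rangle<\psi(|q|)$ for infinitely many $q\in\mathbb{Z}$. $\Omega_\alpha(1,1)=\{\gamma\in[0,1):(\alpha,\gamma)\in W_{1,1}(\psi)\text{ for all }\psi\in\mathcal{D}\}$. For irrational $\alpha$, $w(\alpha)=\sup\{s>0:\langle q\alpha\rangle<q^{-s}\text{ for infinitely many }q\in\mathbb{N}\}$ (irrationality exponent). $\dim_{\rm H}$ is Hausdorff dimension. *)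

theory Defs
  imports "HOL-Analysis.Analysis" "HOL-Library.Extended_Real"
begin

definition dnint :: "real \<Rightarrow> real" where
  "dnint x = \<bar>x - real_of_int (round x)\<bar>"

text \<open>The class D: decreasing (non-increasing) nonnegative functions on the positive
  integers whose series diverges. The value at 0 is irrelevant and left unconstrained.\<close>
definition Dclass :: "(nat \<Rightarrow> real) set" where
  "Dclass = {\<psi>. (\<forall>n\<ge>1. 0 \<le> \<psi> n) \<and> (\<forall>m n. 1 \<le> m \<longrightarrow> m \<le> n \<longrightarrow> \<psi> n \<le> \<psi> m)
                 \<and> \<not> summable (\<lambda>n. \<psi> (Suc n))}"

definition W11 :: "(nat \<Rightarrow> real) \<Rightarrow> (real \<times> real) set" where
  "W11 \<psi> = {(\<alpha>, \<gamma>). \<alpha> \<in> {0..<1} \<and> \<gamma> \<in> {0..<1} \<and>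
              infinite {q::int. dnint (real_of_int q * \<alpha> - \<gamma>) < \<psi> (nat \<bar>q\<bar>)}}"

definition Omega11 :: "real \<Rightarrow> real set" where
  "Omega11 \<alpha> = {\<gamma> \<in> {0..<1}. \<forall>\<psi>\<in>Dclass. (\<alpha>, \<gamma>) \<in> W11 \<psi>}"

definition irr_exp :: "real \<Rightarrow> ereal" where
  "irr_exp \<alpha> = Sup {ereal s | s. s > 0 \<and>
       infinite {q::nat. q > 0 \<and> dnint (real q * \<alpha>) < real q powr (-s)}}"

definition hausdorff_pre :: "real \<Rightarrow> real \<Rightarrow> real set \<Rightarrow> ennreal" where
  "hausdorff_pre s \<delta> E = (INF U \<in> {U :: nat \<Rightarrow> real set.
        E \<subseteq> (\<Union>i. U i) \<and> (\<forall>i. bounded (U i) \<and> diameter (U i) \<le> \<delta>)}.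
        (\<Sum>i. ennreal (diameter (U i) powr s)))"

definition hausdorff_measure :: "real \<Rightarrow> real set \<Rightarrow> ennreal" where
  "hausdorff_measure s E = (SUP \<delta> \<in> {0<..}. hausdorff_pre s \<delta> E)"

definition hausdorff_dim :: "real set \<Rightarrow> real" where
  "hausdorff_dim E = Inf {s. 0 \<le> s \<and> hausdorff_measure s E = 0}"

fun cf_rem :: "real \<Rightarrow> nat \<Rightarrow> real" where
  "cf_rem x 0 = x"
| "cf_rem x (Suc k) = 1 / frac (cf_rem x k)"

definition cf_a :: "real \<Rightarrow> nat \<Rightarrow> int" where
  "cf_a x k = \<lfloor>cf_rem x k\<rfloor>"

fun cf_q :: "real \<Rightarrow> nat \<Rightarrow> int" where
  "cf_q x 0 = 1"
| "cf_q x (Suc 0) = cf_a x 1"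
| "cf_q x (Suc (Suc k)) = cf_a x (Suc (Suc k)) * cf_q x (Suc k) + cf_q x k"

end

theory Submission
  imports Defs "HOL-Real_Asymp.Real_Asymp"
begin

text \<open>
  Testing \<open>\<gamma> \<in> \<Omega>\<^sub>\<alpha>\<close> against the running minimum of \<open>\<langle>n\<alpha> - \<gamma>\<rangle>\<close> shows that for all large \<open>Q\<close> some
  \<open>\<bar>n\<bar> \<le> Q\<close> has \<open>\<langle>n\<alpha> - \<gamma>\<rangle> < 1/Q\<close>. If \<open>\<bar>\<alpha> - p/q\<bar> \<le> 1/Q\<^sup>2\<close>, then \<open>n\<alpha>\<close> lies within \<open>1/Q\<close> of
  \<open>np/q\<close>, so \<open>\<gamma>\<close> lies within \<open>2/Q\<close> of some \<open>j/q\<close>. With \<open>\<langle>q\<alpha>\<rangle> < q\<^sup>-\<^sup>w\<close> and \<open>Q = q\<^bsup>(w+1)/2\<^esup>\<close> this covers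
  \<open>\<Omega>\<^sub>\<alpha>\<close> by \<open>O(q)\<close> intervals of length \<open>O(1/Q)\<close>, which is (i).

  In (ii) take \<open>q = q\<^sub>k\<close> and \<open>Q\<^sup>2 = q\<^sub>k q\<^sub>k\<^sub>+\<^sub>1\<close> for every \<open>k\<close>. A fraction \<open>j/q\<^sub>k\<close> is followed by
  \<open>O(sqrt (q\<^sub>k\<^sub>+\<^sub>1 / q\<^sub>k))\<close> fractions with denominator \<open>q\<^sub>k\<^sub>+\<^sub>1\<close>, so only about \<open>sqrt q\<^sub>k\<close> of the
  fractions \<open>j/q\<^sub>k\<close> are needed, and this halves the exponent. For the lower bound, the points
  \<open>\<Sum>k. a\<^sub>k \<bar>q\<^sub>k\<alpha> - p\<^sub>k\<bar>\<close> with \<open>1 \<le> a\<^sub>k \<le> (q\<^sub>k\<^sub>+\<^sub>1 / q\<^sub>k)\<^sup>v\<close> and \<open>v < 1/2\<close> belong to \<open>\<Omega>\<^sub>\<alpha>\<close>: the partial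
  sums are values \<open>R\<^sub>k\<alpha>\<close> modulo 1 for which \<open>R\<^sub>k\<^sub>+\<^sub>1 \<langle>R\<^sub>k\<alpha> - \<gamma>\<rangle>\<close> is summable. Matching
  these digits with mixed radix expansions of \<open>[0,1)\<close> maps the resulting Cantor set onto \<open>[0,1)\<close> by
  an \<open>s\<close>-Hoelder map for each \<open>s < 1/(w+1)\<close> once \<open>v\<close> is close to \<open>1/2\<close>.
\<close>

section \<open>Hausdorff measure\<close>

lemma hausdorff_measure_zeroI:
  assumes "\<And>d e::real. 0 < d \<Longrightarrow> 0 < e \<Longrightarrow> \<exists>U::nat \<Rightarrow> real set. E \<subseteq> (\<Union>i. U i) \<and>
     (\<forall>i. bounded (U i) \<and> diameter (U i) \<le> d) \<and> (\<Sum>i. ennreal (diameter (U i) powr s)) \<le> ennreal e"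
  shows "hausdorff_measure s E = 0"
proof -
  have "hausdorff_pre s d E = 0" if d: "0 < d" for d
  proof -
    have "hausdorff_pre s d E \<le> 0"
    proof (rule ennreal_le_epsilon)
      fix e :: real assume "0 < e"
      with assms[OF d this] obtain U :: "nat \<Rightarrow> real set" where
        "E \<subseteq> (\<Union>i. U i) \<and> (\<forall>i. bounded (U i) \<and> diameter (U i) \<le> d)"
        "(\<Sum>i. ennreal (diameter (U i) powr s)) \<le> ennreal e" by blast
      then show "hausdorff_pre s d E \<le> 0 + ennreal e"
        unfolding hausdorff_pre_def by (auto intro!: INF_lower2[of U])
    qed
    then show ?thesis by simp
  qed
  then show ?thesis unfolding hausdorff_measure_def by simp
qed

lemma hausdorff_measure_zeroD:
  assumes "hausdorff_measure s E = 0" "0 < d" "0 < e"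
  obtains U :: "nat \<Rightarrow> real set" where "E \<subseteq> (\<Union>i. U i)"
    "\<And>i. bounded (U i)" "\<And>i. diameter (U i) \<le> d" "(\<Sum>i. ennreal (diameter (U i) powr s)) < ennreal e"
proof -
  have "hausdorff_pre s d E \<le> hausdorff_measure s E"
    unfolding hausdorff_measure_def using assms(2) by (intro SUP_upper) auto
  then have "hausdorff_pre s d E < ennreal e"
    using assms by simp
  then show ?thesis
    unfolding hausdorff_pre_def INF_less_iff using that by auto
qed

lemma hausdorff_measure_zero_subset:
  assumes "hausdorff_measure s E = 0" "F \<subseteq> E"
  shows "hausdorff_measure s F = 0"
proof (rule hausdorff_measure_zeroI)
  fix d e :: real assume "0 < d" "0 < e"
  from hausdorff_measure_zeroD[OF assms(1) this] obtain U :: "nat \<Rightarrow> real set" where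
    "E \<subseteq> (\<Union>i. U i)" "\<And>i. bounded (U i)" "\<And>i. diameter (U i) \<le> d"
    "(\<Sum>i. ennreal (diameter (U i) powr s)) < ennreal e" by blast
  then show "\<exists>U::nat \<Rightarrow> real set. F \<subseteq> (\<Union>i. U i) \<and> (\<forall>i. bounded (U i) \<and> diameter (U i) \<le> d)
      \<and> (\<Sum>i. ennreal (diameter (U i) powr s)) \<le> ennreal e"
    using assms(2) by (intro exI[of _ U]) (auto simp: less_imp_le)
qed

lemma hausdorff_measure_zero_UN:
  assumes "\<And>n::nat. hausdorff_measure s (E n) = 0"
  shows "hausdorff_measure s (\<Union>n. E n) = 0"
proof (rule hausdorff_measure_zeroI)
  fix d e :: real assume d: "0 < d" and e: "0 < e"
  define P where "P = (\<lambda>n (U :: nat \<Rightarrow> real set). E n \<subseteq> (\<Union>i. U i) \<and>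
      (\<forall>i. bounded (U i) \<and> diameter (U i) \<le> d) \<and>
      (\<Sum>i. ennreal (diameter (U i) powr s)) < ennreal (e * (1/2)^Suc n))"
  have "\<exists>U. P n U" for n
  proof -
    have "0 < e * (1/2)^Suc n" using e by simp
    show ?thesis unfolding P_def
      by (rule hausdorff_measure_zeroD[OF assms[of n] d \<open>0 < e * (1/2)^Suc n\<close>]) blast
  qed
  then obtain U where "\<And>n. P n (U n)" by metis
  then have U: "\<And>n. E n \<subseteq> (\<Union>i. U n i)"
    "\<And>n i. bounded (U n i)" "\<And>n i. diameter (U n i) \<le> d"
    "\<And>n. (\<Sum>i. ennreal (diameter (U n i) powr s)) < ennreal (e * (1/2)^Suc n)"
    unfolding P_def by blast+
  define V where "V = (\<lambda>m. case_prod U (prod_decode m))"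
  have "(\<Union>n. E n) \<subseteq> (\<Union>m. V m)"
  proof
    fix x assume "x \<in> (\<Union>n. E n)"
    then obtain n i where "x \<in> U n i" using U(1) by blast
    then have "x \<in> V (prod_encode (n, i))" by (simp add: V_def)
    then show "x \<in> (\<Union>m. V m)" by blast
  qed
  moreover have "bounded (V m) \<and> diameter (V m) \<le> d" for m
    using U(2,3) by (simp add: V_def split: prod.split)
  moreover have "(\<Sum>m. ennreal (diameter (V m) powr s)) \<le> ennreal e"
  proof -
    have "(\<Sum>m. ennreal (diameter (V m) powr s))
        = (\<Sum>m. (\<lambda>(n, i). ennreal (diameter (U n i) powr s)) (prod_decode m))"
      by (simp add: V_def case_prod_unfold)
    also have "\<dots> = (\<Sum>n. \<Sum>i. ennreal (diameter (U n i) powr s))"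
      by (subst suminf_ennreal_2dimen[where f = "\<lambda>(n, i). ennreal (diameter (U n i) powr s)"]) auto
    also have "\<dots> \<le> (\<Sum>n. ennreal (e * (1/2)^Suc n))"
      using U(4) by (intro suminf_le) (auto simp: less_imp_le)
    also have "\<dots> = ennreal e"
      using e sums_mult[OF power_half_series, of e]
      by (intro suminf_ennreal_eq) (auto simp: sums_iff)
    finally show ?thesis .
  qed
  ultimately show "\<exists>U::nat \<Rightarrow> real set. (\<Union>n. E n) \<subseteq> (\<Union>i. U i) \<and>
      (\<forall>i. bounded (U i) \<and> diameter (U i) \<le> d) \<and> (\<Sum>i. ennreal (diameter (U i) powr s)) \<le> ennreal e"
    by blast
qed

text \<open>Both covering arguments below produce finitely many balls of equal radius, so a single
  \<open>e\<close> can bound mesh and cost together. The empty sets that pad the cover to a sequence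
  cost nothing, since \<open>0 powr s = 0\<close> for every \<open>s\<close>.\<close>

lemma hausdorff_measure_zero_finite_cover:
  assumes "\<And>e::real. 0 < e \<Longrightarrow> \<exists>S r. finite S \<and> 0 < r \<and> r < e \<and>
     E \<subseteq> (\<Union>x\<in>S. cball x r) \<and> real (card S) * (2 * r) powr s < e"
  shows "hausdorff_measure s E = 0"
proof (rule hausdorff_measure_zeroI)
  fix d e :: real assume d: "0 < d" and e: "0 < e"
  obtain S r where S: "finite S" "0 < r" "r < min (d/2) e" "E \<subseteq> (\<Union>x\<in>S. cball x r)"
    "real (card S) * (2 * r) powr s < min (d/2) e"
    using assms[of "min (d/2) e"] d e by auto
  obtain h where h: "bij_betw h {0..<card S} S"
    using ex_bij_betw_nat_finite[OF S(1)] by blast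
  define U where "U = (\<lambda>i. if i < card S then cball (h i) r else {})"
  have "E \<subseteq> (\<Union>i. U i)"
  proof
    fix x assume "x \<in> E"
    then obtain y where "y \<in> S" "x \<in> cball y r" using S(4) by blast
    moreover obtain i where "i < card S" "y = h i"
      using bij_betw_imp_surj_on[OF h] \<open>y \<in> S\<close> by (metis atLeastLessThan_iff image_iff)
    ultimately have "x \<in> U i" by (simp add: U_def)
    then show "x \<in> (\<Union>i. U i)" by blast
  qed
  moreover have "bounded (U i) \<and> diameter (U i) \<le> d" for i
    using S(2,3) d by (auto simp: U_def)
  moreover have "(\<Sum>i. ennreal (diameter (U i) powr s)) \<le> ennreal e"
  proof -
    have "(\<Sum>i. ennreal (diameter (U i) powr s)) = (\<Sum>i\<in>{..<card S}. ennreal (diameter (U i) powr s))"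
      by (intro suminf_finite) (auto simp: U_def)
    also have "\<dots> = (\<Sum>i\<in>{..<card S}. ennreal ((2 * r) powr s))"
      using S(2) by (intro sum.cong) (auto simp: U_def)
    also have "\<dots> = ennreal (real (card S) * (2 * r) powr s)"
      by (subst sum_ennreal) auto
    also have "\<dots> \<le> ennreal e" using S(5) by (intro ennreal_leI) auto
    finally show ?thesis .
  qed
  ultimately show "\<exists>U::nat \<Rightarrow> real set. E \<subseteq> (\<Union>i. U i) \<and>
      (\<forall>i. bounded (U i) \<and> diameter (U i) \<le> d) \<and> (\<Sum>i. ennreal (diameter (U i) powr s)) \<le> ennreal e"
    by blast
qed

lemma hausdorff_dim_le:
  assumes "0 \<le> s" "hausdorff_measure s E = 0"
  shows "hausdorff_dim E \<le> s"
  unfolding hausdorff_dim_def by (rule cInf_lower) (use assms in \<open>auto intro!: bdd_belowI[of _ 0]\<close>)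

text \<open>The sets \<open>A i\<close> need not be measurable. Each is enclosed in a closed
  interval of radius \<open>b i\<close> about one of its points, and countable subadditivity of
  Lebesgue measure is applied to these intervals.\<close>

lemma one_le_sum_of_cover_Ico:
  fixes A :: "nat \<Rightarrow> real set"
  assumes "{0..<1} \<subseteq> (\<Union>i. A i)"
    and "\<And>i x y. x \<in> A i \<Longrightarrow> y \<in> A i \<Longrightarrow> \<bar>x - y\<bar> \<le> b i" "\<And>i. 0 \<le> b i"
  shows "1 \<le> (\<Sum>i. ennreal (2 * b i))"
proof -
  define c where "c = (\<lambda>i. SOME x. x \<in> A i)"
  define I where "I = (\<lambda>i. {c i - b i .. c i + b i})"
  have "{0..<1::real} \<subseteq> (\<Union>i. I i)"
  proof
    fix x :: real assume "x \<in> {0..<1}"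
    then obtain i where "x \<in> A i" using assms(1) by blast
    moreover from this have "c i \<in> A i" unfolding c_def by (rule someI)
    ultimately have "x \<in> I i" using assms(2)[of x i "c i"] by (auto simp: I_def)
    then show "x \<in> (\<Union>i. I i)" by blast
  qed
  then have "emeasure lborel {0..<1::real} \<le> emeasure lborel (\<Union>i. I i)"
    by (intro emeasure_mono) (auto simp: I_def)
  also have "\<dots> \<le> (\<Sum>i. emeasure lborel (I i))"
    by (intro emeasure_subadditive_countably) (auto simp: I_def)
  also have "\<dots> = (\<Sum>i. ennreal (2 * b i))"
    using assms(3) by (simp add: I_def)
  finally show ?thesis by simp
qed

text \<open>A mass distribution principle in which the mass is Lebesgue measure transported by \<open>G\<close>.\<close>
lemma hausdorff_measure_nonzero:
  assumes G: "\<And>t. t \<in> {0..<1} \<Longrightarrow> G t \<in> E"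
    and H: "\<And>t u. t \<in> {0..<1} \<Longrightarrow> u \<in> {0..<1} \<Longrightarrow> \<bar>t - u\<bar> \<le> L * \<bar>G t - G u\<bar> powr s"
    and L: "0 < L" and t: "0 \<le> t" "t \<le> s"
  shows "hausdorff_measure t E \<noteq> 0"
proof
  assume "hausdorff_measure t E = 0"
  moreover have "0 < 1 / (2 * L)" using L by simp
  ultimately obtain U :: "nat \<Rightarrow> real set" where U: "E \<subseteq> (\<Union>i. U i)"
    "\<And>i. bounded (U i)" "\<And>i. diameter (U i) \<le> 1"
    "(\<Sum>i. ennreal (diameter (U i) powr t)) < ennreal (1 / (2 * L))"
    using hausdorff_measure_zeroD[of t E 1 "1 / (2 * L)"] zero_less_one by blast
  define A where "A = (\<lambda>i. {x \<in> {0..<1}. G x \<in> U i})"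
  define b where "b = (\<lambda>i. L * diameter (U i) powr t)"
  have "1 \<le> (\<Sum>i. ennreal (2 * b i))"
  proof (rule one_le_sum_of_cover_Ico)
    show "{0..<1} \<subseteq> (\<Union>i. A i)" using U(1) G unfolding A_def by blast
    show "0 \<le> b i" for i using L by (simp add: b_def)
    fix i x y assume xy: "x \<in> A i" "y \<in> A i"
    have dd: "\<bar>G x - G y\<bar> \<le> diameter (U i)"
      using diameter_bounded_bound[OF U(2), of "G x" i "G y"] xy by (simp add: A_def dist_real_def)
    \<comment> \<open>The distance is at most 1, so lowering the exponent from \<open>s\<close> to
      \<open>t\<close> can only enlarge the power.\<close>
    have "\<bar>G x - G y\<bar> powr s \<le> \<bar>G x - G y\<bar> powr t"
      using powr_mono'[OF t(2), of "\<bar>G x - G y\<bar>"] dd U(3)[of i] by simp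
    also have "\<dots> \<le> diameter (U i) powr t"
      using dd t by (intro powr_mono2) auto
    finally have "L * \<bar>G x - G y\<bar> powr s \<le> b i" using L by (simp add: b_def)
    then show "\<bar>x - y\<bar> \<le> b i" using H[of x y] xy by (simp add: A_def)
  qed
  also have "\<dots> = (\<Sum>i. ennreal (2 * L) * ennreal (diameter (U i) powr t))"
    using L by (simp add: b_def ennreal_mult' mult.assoc)
  also have "\<dots> = ennreal (2 * L) * (\<Sum>i. ennreal (diameter (U i) powr t))"
    by (simp add: ennreal_suminf_cmult)
  also have "\<dots> < ennreal (2 * L) * ennreal (1 / (2 * L))"
    using U(4) L by (intro ennreal_mult_strict_left_mono) auto
  also have "\<dots> = 1" using L by (simp flip: ennreal_mult')
  finally show False by simp
qed

text \<open>A lower bound for the real-valued \<open>Inf\<close> in \<open>hausdorff_dim\<close>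
  requires a nonempty set; the exponent \<open>u\<close> supplies an element.\<close>

lemma hausdorff_dim_ge:
  assumes "\<And>t. 0 \<le> t \<Longrightarrow> t < s \<Longrightarrow> hausdorff_measure t E \<noteq> 0"
    and "0 \<le> u" "hausdorff_measure u E = 0"
  shows "s \<le> hausdorff_dim E"
  unfolding hausdorff_dim_def by (rule cInf_greatest) (use assms in force)+

section \<open>Covering by rationals\<close>

lemma dnint_le: "dnint x \<le> \<bar>x - of_int m\<bar>"
  unfolding dnint_def using round_diff_minimal[of x m] by (simp add: abs_minus_commute)

lemma dnint_nonneg: "0 \<le> dnint x"
  by (simp add: dnint_def)

text \<open>The threshold \<open>N\<close> is uniform in \<gamma>, so that one cover at a scale
  \<open>Q\<close> beyond \<open>N\<close> serves all points of the set. The scale is real because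
  it will be a power of a denominator.\<close>

definition approximable :: "real \<Rightarrow> nat \<Rightarrow> real set" where
  "approximable \<alpha> N = {\<gamma> \<in> {0..<1}. \<forall>Q::real. real N \<le> Q \<longrightarrow>
     (\<exists>n m::int. \<bar>of_int n\<bar> \<le> Q \<and> \<bar>of_int n * \<alpha> - \<gamma> - of_int m\<bar> < 1 / Q)}"

text \<open>The running minimum of \<open>\<langle>n\<alpha> - \<gamma>\<rangle>\<close> is the largest decreasing function that \<open>\<gamma>\<close> never beats;
  if \<open>\<gamma>\<close> lies in \<open>\<Omega>\<^sub>\<alpha>\<close> its sum converges, hence the minimum is \<open>o(1/Q)\<close>.\<close>
lemma Omega11_subset_approximable: "Omega11 \<alpha> \<subseteq> (\<Union>N. approximable \<alpha> N)"
proof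
  fix \<gamma> assume \<gamma>: "\<gamma> \<in> Omega11 \<alpha>"
  define d where "d = (\<lambda>j::int. dnint (of_int j * \<alpha> - \<gamma>))"
  define \<psi> where "\<psi> = (\<lambda>M::nat. Min (d ` {- int M..int M}))"
  have \<psi>_le: "\<psi> M \<le> d j" if "\<bar>j\<bar> \<le> int M" for M j
    unfolding \<psi>_def using that by (intro Min_le imageI) auto
  have \<psi>_nonneg: "0 \<le> \<psi> M" for M
    unfolding \<psi>_def by (subst Min_ge_iff) (auto simp: d_def dnint_nonneg)
  have \<psi>_mono: "\<psi> n \<le> \<psi> m" if "m \<le> n" for m n
    unfolding \<psi>_def using that by (intro Min_antimono) auto
  have "{q::int. dnint (of_int q * \<alpha> - \<gamma>) < \<psi> (nat \<bar>q\<bar>)} = {}"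
    using \<psi>_le by (force simp: d_def not_less)
  then have "(\<alpha>, \<gamma>) \<notin> W11 \<psi>" by (simp add: W11_def)
  then have "\<psi> \<notin> Dclass" using \<gamma> by (auto simp: Omega11_def)
  then have sm: "summable (\<lambda>n. \<psi> (Suc n))"
    using \<psi>_nonneg \<psi>_mono by (auto simp: Dclass_def)
  obtain N where N: "\<And>m n. N \<le> m \<Longrightarrow> norm (sum (\<lambda>n. \<psi> (Suc n)) {m..<n}) < 1/4"
    using sm unfolding summable_Cauchy by (metis zero_less_divide_1_iff zero_less_numeral)
  have "\<gamma> \<in> approximable \<alpha> (2 * N + 2)"
    unfolding approximable_def
  proof (intro CollectI conjI allI impI)
    show "\<gamma> \<in> {0..<1}" using \<gamma> by (simp add: Omega11_def)
    fix Q :: real assume Q: "real (2 * N + 2) \<le> Q"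
    define M where "M = nat \<lfloor>Q\<rfloor>"
    have M: "real M \<le> Q" "Q < real M + 1" "2 * N + 2 \<le> M"
      using Q unfolding M_def by (auto simp: le_nat_floor)
    \<comment> \<open>The block from \<open>N\<close> to \<open>M\<close> has at least
      \<open>M / 2\<close> terms, each at least \<open>\<psi> M\<close>, and its sum is below 1/4.
      Hence \<open>\<psi> M\<close> is below \<open>1 / (2 * M)\<close>, and
      \<open>Q < M + 1\<close> turns this into \<open>1 / Q\<close>.\<close>
    have "(\<Sum>i\<in>{N..<M}. \<psi> M) \<le> sum (\<lambda>n. \<psi> (Suc n)) {N..<M}"
      by (intro sum_mono \<psi>_mono) auto
    also have "\<dots> < 1/4" using N[of N M] by simp
    finally have "real (M - N) * \<psi> M < 1/4" by simp
    moreover have "real M / 2 * \<psi> M \<le> real (M - N) * \<psi> M"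
      using M(3) \<psi>_nonneg by (intro mult_right_mono) (auto simp: of_nat_diff)
    ultimately have "\<psi> M < 1 / (2 * real M)" using M(3) by (simp add: field_simps)
    also have "\<dots> \<le> 1 / Q" using M by (intro divide_left_mono) auto
    finally have lt: "\<psi> M < 1 / Q" .
    have "\<psi> M \<in> d ` {- int M..int M}"
      unfolding \<psi>_def by (intro Min_in) auto
    then obtain n where "n \<in> {- int M..int M}" "\<psi> M = d n" by blast
    then have n: "\<bar>n\<bar> \<le> int M" "d n < 1 / Q" using lt by auto
    have "\<bar>real_of_int n\<bar> \<le> real M" using n(1) by linarith
    then show "\<exists>n m::int. \<bar>of_int n\<bar> \<le> Q \<and> \<bar>of_int n * \<alpha> - \<gamma> - of_int m\<bar> < 1 / Q"
      using n(2) M(1) unfolding d_def dnint_def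
      by (intro exI[of _ n] exI[of _ "round (of_int n * \<alpha> - \<gamma>)"]) auto
  qed
  then show "\<gamma> \<in> (\<Union>N. approximable \<alpha> N)" by blast
qed

lemma approximable_near_rational:
  fixes p q :: int
  assumes "\<gamma> \<in> approximable \<alpha> N" "real N \<le> Q" "0 < Q" "0 < q" "\<bar>\<alpha> - p / q\<bar> \<le> 1 / Q\<^sup>2"
  obtains j :: int where "\<bar>\<gamma> - j / q\<bar> \<le> 2 / Q"
proof -
  obtain n m :: int where nm: "\<bar>of_int n\<bar> \<le> Q" "\<bar>of_int n * \<alpha> - \<gamma> - of_int m\<bar> < 1 / Q"
    using assms(1,2) unfolding approximable_def by blast
  have "\<bar>of_int n * (\<alpha> - p / q)\<bar> \<le> Q * (1 / Q\<^sup>2)"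
    unfolding abs_mult using nm(1) assms by (intro mult_mono) auto
  also have "\<dots> = 1 / Q" using assms(3) by (simp add: power2_eq_square)
  finally have "\<bar>of_int n * \<alpha> - of_int n * (p / q)\<bar> \<le> 1 / Q" by (simp only: right_diff_distrib)
  moreover have "of_int n * (of_int p / of_int q) - of_int m = real_of_int (n * p - m * q) / of_int q"
    using assms(4) by (simp add: field_simps)
  ultimately have "\<bar>\<gamma> - of_int (n * p - m * q) / of_int q\<bar> \<le> 1 / Q + 1 / Q"
    using nm(2) by linarith
  then show ?thesis using that[of "n * p - m * q"] by simp
qed

lemma approximable_null:
  fixes w s :: real
  assumes w: "0 < w" and s: "2 / (w + 1) < s"
    and inf: "infinite {q::nat. q > 0 \<and> dnint (real q * \<alpha>) < real q powr (-w)}"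
  shows "hausdorff_measure s (approximable \<alpha> N) = 0"
proof (rule hausdorff_measure_zero_finite_cover)
  fix e :: real assume e: "0 < e"
  \<comment> \<open>With this exponent \<open>Q\<^sup>2\<close> equals
    \<open>q powr (w + 1)\<close>, the inverse of the available bound on the distance from \<alpha>
    to \<open>p / q\<close>. The hypothesis on \<open>s\<close> says exactly that
    \<open>b * s > 1\<close>, so about \<open>q\<close> intervals of length \<open>1 / Q\<close>
    have vanishing total cost.\<close>
  define b where "b = (w + 1) / 2"
  have b: "0 < b" "1 < b * s" using w s by (simp_all add: b_def field_simps)
  have "eventually (\<lambda>x::nat. 2 / real x powr b < min e 1 \<and> real N \<le> real x powr b \<and>
      7 * real x * (2 * (2 / real x powr b)) powr s < e) at_top"
  proof (intro eventually_conj)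
    have "((\<lambda>x::nat. 2 / real x powr b) \<longlongrightarrow> 0) at_top" using b by real_asymp
    then show "eventually (\<lambda>x::nat. 2 / real x powr b < min e 1) at_top"
      by (rule order_tendstoD) (use e in auto)
    have "filterlim (\<lambda>x::nat. real x powr b) at_top at_top" using b by real_asymp
    then show "eventually (\<lambda>x::nat. real N \<le> real x powr b) at_top"
      by (auto simp: filterlim_at_top)
    have "((\<lambda>x::nat. 7 * 4 powr s * real x powr (1 - b * s)) \<longlongrightarrow> 0) at_top"
      using b by real_asymp
    then have "eventually (\<lambda>x::nat. 7 * 4 powr s * real x powr (1 - b * s) < e) at_top"
      by (rule order_tendstoD) (use e in auto)
    then show "eventually (\<lambda>x::nat. 7 * real x * (2 * (2 / real x powr b)) powr s < e) at_top"
      using eventually_gt_at_top[of 0]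
      by eventually_elim (auto simp: powr_divide powr_powr powr_diff mult_ac)
  qed
  then obtain X where X: "\<And>x::nat. X \<le> x \<Longrightarrow> 2 / real x powr b < min e 1 \<and> real N \<le> real x powr b \<and>
      7 * real x * (2 * (2 / real x powr b)) powr s < e"
    by (auto simp: eventually_at_top_linorder)
  obtain q where q: "X \<le> q" "0 < q" "dnint (real q * \<alpha>) < real q powr (-w)"
    using inf unfolding infinite_nat_iff_unbounded_le by blast
  define Q where "Q = real q powr b"
  have Q: "0 < Q" "2 / Q < e" "2 / Q < 1" "real N \<le> Q" "7 * real q * (2 * (2 / Q)) powr s < e"
    using X[OF q(1)] q(2) by (auto simp: Q_def)
  have QQ: "Q\<^sup>2 = real q * real q powr w"
  proof -
    have "Q\<^sup>2 = real q powr (b + b)" by (simp add: Q_def power2_eq_square flip: powr_add)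
    also have "b + b = 1 + w" by (simp add: b_def)
    finally show ?thesis using q(2) by (simp add: powr_add)
  qed
  define p where "p = round (real q * \<alpha>)"
  have "\<bar>real q * \<alpha> - p\<bar> \<le> real q powr (-w)" using q(3) by (simp add: dnint_def p_def)
  then have "\<bar>(real q * \<alpha> - p) / q\<bar> \<le> real q powr (-w) / q"
    using q(2) by (simp add: divide_right_mono)
  moreover have "(real q * \<alpha> - p) / q = \<alpha> - p / of_int (int q)"
    using q(2) by (simp add: diff_divide_distrib)
  moreover have "real q powr (-w) / q = 1 / Q\<^sup>2"
    by (simp add: QQ powr_minus divide_simps)
  ultimately have app: "\<bar>\<alpha> - p / of_int (int q)\<bar> \<le> 1 / Q\<^sup>2" by simp
  \<comment> \<open>A generous range: \<gamma> lies in the unit interval and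
    \<open>2 / Q < 1\<close>. It has \<open>6 * q + 1\<close> elements, which accounts for the 7
    above.\<close>
  define S where "S = (\<lambda>j::int. j / real q) ` {- 3 * int q..3 * int q}"
  have "approximable \<alpha> N \<subseteq> (\<Union>x\<in>S. cball x (2 / Q))"
  proof
    fix \<gamma> assume \<gamma>: "\<gamma> \<in> approximable \<alpha> N"
    obtain j :: int where j: "\<bar>\<gamma> - j / of_int (int q)\<bar> \<le> 2 / Q"
      using approximable_near_rational[OF \<gamma> Q(4,1) _ app] q(2) of_nat_0_less_iff by blast
    have "\<bar>real_of_int j / real q\<bar> < 3"
      using j Q(3) \<gamma> unfolding approximable_def by simp linarith
    then have "\<bar>real_of_int j\<bar> < 3 * real q" using q(2) by (simp add: field_simps)
    then have "j \<in> {- 3 * int q..3 * int q}" by simp linarith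
    then have "j / real q \<in> S" unfolding S_def by (rule imageI)
    moreover have "\<gamma> \<in> cball (j / real q) (2 / Q)"
      using j by (simp add: dist_real_def abs_minus_commute)
    ultimately show "\<gamma> \<in> (\<Union>x\<in>S. cball x (2 / Q))" by blast
  qed
  moreover have "real (card S) * (2 * (2 / Q)) powr s < e"
  proof -
    have "card S \<le> card {- 3 * int q..3 * int q}"
      unfolding S_def by (intro card_image_le) auto
    then have "real (card S) \<le> 7 * real q" using q(2) by simp
    then have "real (card S) * (2 * (2 / Q)) powr s \<le> 7 * real q * (2 * (2 / Q)) powr s"
      by (intro mult_right_mono) auto
    then show ?thesis using Q(5) by linarith
  qed
  moreover have "finite S" by (simp add: S_def)
  ultimately show "\<exists>S r. finite S \<and> 0 < r \<and> r < e \<and> approximable \<alpha> N \<subseteq> (\<Union>x\<in>S. cball x r) \<and>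
      real (card S) * (2 * r) powr s < e"
    using Q(1,2) by (intro exI[of _ S] exI[of _ "2 / Q"]) auto
qed

lemma Omega11_null:
  assumes "\<And>N. hausdorff_measure s (approximable \<alpha> N) = 0"
  shows "hausdorff_measure s (Omega11 \<alpha>) = 0"
  using hausdorff_measure_zero_subset[OF hausdorff_measure_zero_UN[of s "approximable \<alpha>", OF assms]
      Omega11_subset_approximable] .

section \<open>Convergents\<close>

text \<open>Numerators of the convergents, built by the recurrence of \<open>cf_q\<close> with the
  usual starting values 1 and 0 for the numerator and denominator of index -1.\<close>

fun cf_p :: "real \<Rightarrow> nat \<Rightarrow> int" where
  "cf_p x 0 = cf_a x 0"
| "cf_p x (Suc 0) = cf_a x 1 * cf_a x 0 + 1"
| "cf_p x (Suc (Suc k)) = cf_a x (Suc (Suc k)) * cf_p x (Suc k) + cf_p x k"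

lemma cf_rem_irrational: "x \<notin> \<rat> \<Longrightarrow> cf_rem x k \<notin> \<rat>"
proof (induction k)
  case (Suc k)
  show ?case
  proof
    assume "cf_rem x (Suc k) \<in> \<rat>"
    then have "inverse (cf_rem x (Suc k)) \<in> \<rat>" by (rule Rats_inverse)
    then have "frac (cf_rem x k) + of_int \<lfloor>cf_rem x k\<rfloor> \<in> \<rat>"
      by (intro Rats_add) (simp_all add: field_simps)
    with Suc show False by (simp add: frac_def)
  qed
qed simp

lemma frac_cf_rem: "x \<notin> \<rat> \<Longrightarrow> 0 < frac (cf_rem x k)"
  using cf_rem_irrational[of x k] Ints_subset_Rats by (auto simp: frac_gt_0_iff)

lemma cf_a_Suc_pos: "x \<notin> \<rat> \<Longrightarrow> 1 \<le> cf_a x (Suc k)"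
  using frac_cf_rem[of x k] frac_lt_1[of "cf_rem x k"] by (simp add: cf_a_def le_floor_iff)

text \<open>The three bounds are carried through one induction: positivity of the older denominator
  raises the linear lower bound by 1 at each step. That bound later gives divergence to
  infinity.\<close>

lemma cf_q_ge: "x \<notin> \<rat> \<Longrightarrow> 1 \<le> cf_q x k \<and> cf_q x k \<le> cf_q x (Suc k) \<and> int k \<le> cf_q x (Suc k)"
proof (induction k)
  case 0
  then show ?case using cf_a_Suc_pos[of x 0] by simp
next
  case (Suc k)
  then have "1 * cf_q x (Suc k) \<le> cf_a x (Suc (Suc k)) * cf_q x (Suc k)"
    using cf_a_Suc_pos[of x "Suc k"] by (intro mult_right_mono) auto
  then show ?case using Suc unfolding cf_q.simps by (intro conjI) linarith+
qed

text \<open>The error is kept signed, so that it obeys the same linear recurrence as numerators and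
  denominators.\<close>

definition cf_theta :: "real \<Rightarrow> nat \<Rightarrow> real" where
  "cf_theta x k = of_int (cf_q x k) * x - of_int (cf_p x k)"

lemma cf_theta_0: "cf_theta x 0 = frac x"
  by (simp add: cf_theta_def cf_a_def frac_def)

lemma cf_theta_rec:
  "cf_theta x (Suc (Suc k)) = of_int (cf_a x (Suc (Suc k))) * cf_theta x (Suc k) + cf_theta x k"
  by (simp add: cf_theta_def algebra_simps)

text \<open>If the previous ratio is \<open>- f\<close>, the recurrence multiplies the current error
  by \<open>a - 1 / f\<close>, where \<open>a\<close> is the integer part of \<open>1 / f\<close>;
  this is minus the next fractional part.\<close>

lemma cf_theta_Suc: "x \<notin> \<rat> \<Longrightarrow> cf_theta x (Suc k) = - cf_theta x k * frac (cf_rem x (Suc k))"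
proof (induction k)
  case 0
  have "cf_theta x (Suc 0) = of_int (cf_a x 1) * frac x - 1"
    by (simp add: cf_theta_def frac_def cf_a_def algebra_simps)
  also have "\<dots> = - frac x * frac (1 / frac x)"
    using frac_cf_rem[OF 0, of 0] by (simp add: frac_def[of "1 / frac x"] cf_a_def algebra_simps)
  finally show ?case by (simp add: cf_theta_0)
next
  case (Suc k)
  define f where "f = frac (cf_rem x (Suc k))"
  have f: "f > 0" unfolding f_def by (rule frac_cf_rem[OF Suc.prems])
  have "cf_theta x k = - cf_theta x (Suc k) * (1 / f)"
    using Suc f by (simp add: f_def)
  moreover have "frac (cf_rem x (Suc (Suc k))) = 1 / f - of_int (cf_a x (Suc (Suc k)))"
    unfolding f_def cf_a_def cf_rem.simps(2)[of x "Suc k"]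
    by (simp only: frac_def[of "1 / frac (cf_rem x (Suc k))"])
  ultimately show ?case by (simp only: cf_theta_rec) (simp add: algebra_simps)
qed

text \<open>A two by two determinant: the recurrence replaces one column by itself plus a multiple
  of the other and exchanges them, so only the sign changes.\<close>

lemma cf_theta_det: "of_int (cf_q x (Suc k)) * cf_theta x k - of_int (cf_q x k) * cf_theta x (Suc k) = (-1) ^ k"
proof (induction k)
  case 0
  show ?case by (simp add: cf_theta_def algebra_simps)
next
  case (Suc k)
  have "of_int (cf_q x (Suc (Suc k))) * cf_theta x (Suc k) - of_int (cf_q x (Suc k)) * cf_theta x (Suc (Suc k))
      = - (of_int (cf_q x (Suc k)) * cf_theta x k - of_int (cf_q x k) * cf_theta x (Suc k))"
    by (simp only: cf_theta_rec) (simp add: algebra_simps)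
  then show ?case using Suc by simp
qed

lemma coprime_cf_p_cf_q: "coprime (cf_p x k) (cf_q x k)"
proof -
  have "real_of_int (cf_q x k * cf_p x (Suc k) - cf_q x (Suc k) * cf_p x k) = (-1) ^ k"
    using cf_theta_det[of x k] by (simp add: cf_theta_def algebra_simps)
  also have "\<dots> = real_of_int ((-1) ^ k)" by simp
  finally have det: "cf_q x k * cf_p x (Suc k) - cf_q x (Suc k) * cf_p x k = (-1) ^ k"
    by (simp only: of_int_eq_iff)
  show ?thesis
  proof (rule coprimeI)
    fix c assume "c dvd cf_p x k" "c dvd cf_q x k"
    then have "c dvd (-1) ^ k" unfolding det[symmetric] by (intro dvd_diff) auto
    then show "is_unit c" by (metis dvd_trans is_unit_power_iff dvd_refl minus_dvd_iff)
  qed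
qed

text \<open>Inserting the ratio of consecutive errors into the determinant shows that the error
  times \<open>cf_q x (Suc k) + cf_q x k * f\<close>, with \<open>f\<close> in the unit interval,
  has absolute value 1. That factor lies between \<open>cf_q x (Suc k)\<close> and twice this
  number.\<close>

lemma cf_theta_bounds:
  assumes x: "x \<notin> \<rat>"
  shows "\<bar>cf_theta x k\<bar> \<le> 1 / of_int (cf_q x (Suc k))" "1 / (2 * of_int (cf_q x (Suc k))) \<le> \<bar>cf_theta x k\<bar>"
proof -
  define f a b t where "f = frac (cf_rem x (Suc k))" and "a = real_of_int (cf_q x (Suc k))"
    and "b = real_of_int (cf_q x k)" and "t = cf_theta x k"
  have f: "0 \<le> f" "f \<le> 1" using frac_lt_1[of "cf_rem x (Suc k)"] by (auto simp: f_def less_imp_le)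
  have ab: "1 \<le> a" "0 \<le> b" "b \<le> a"
    using cf_q_ge[OF x, of k] cf_q_ge[OF x, of "Suc k"] by (auto simp: a_def b_def)
  have "(a + b * f) * t = (-1) ^ k"
    using cf_theta_det[of x k] cf_theta_Suc[OF x, of k]
    by (simp add: a_def b_def f_def t_def algebra_simps)
  then have "\<bar>(a + b * f) * t\<bar> = 1" by simp
  then have t: "(a + b * f) * \<bar>t\<bar> = 1" using ab f by (simp add: abs_mult)
  have bf: "0 \<le> b * f" "b * f \<le> a" using ab f mult_mono[of b a f 1] by auto
  have "a * \<bar>t\<bar> \<le> (a + b * f) * \<bar>t\<bar>" using bf by (intro mult_right_mono) auto
  then show "\<bar>cf_theta x k\<bar> \<le> 1 / of_int (cf_q x (Suc k))"
    using t ab unfolding a_def[symmetric] t_def[symmetric] by (simp add: field_simps)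
  have "(a + b * f) * \<bar>t\<bar> \<le> (2 * a) * \<bar>t\<bar>" using bf by (intro mult_right_mono) auto
  then show "1 / (2 * of_int (cf_q x (Suc k))) \<le> \<bar>cf_theta x k\<bar>"
    using t ab unfolding a_def[symmetric] t_def[symmetric] by (simp add: field_simps)
qed

section \<open>Mixed radix expansions and Cantor series\<close>

fun radix_rem :: "(nat \<Rightarrow> nat) \<Rightarrow> real \<Rightarrow> nat \<Rightarrow> real" where
  "radix_rem J t 0 = t"
| "radix_rem J t (Suc k) = frac (radix_rem J t k * real (J k))"

definition radix_digit :: "(nat \<Rightarrow> nat) \<Rightarrow> real \<Rightarrow> nat \<Rightarrow> nat" where
  "radix_digit J t k = nat \<lfloor>radix_rem J t k * real (J k)\<rfloor>"

lemma radix_rem_Ico: "t \<in> {0..<1} \<Longrightarrow> radix_rem J t k \<in> {0..<1}"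
  by (cases k) (auto simp: frac_lt_1)

declare radix_rem.simps(2) [simp del]

lemma radix_digit_rem:
  assumes "t \<in> {0..<1}"
  shows "radix_rem J t k * real (J k) = real (radix_digit J t k) + radix_rem J t (Suc k)"
proof -
  have "0 \<le> radix_rem J t k * real (J k)" using radix_rem_Ico[OF assms, of J k] by simp
  then have "0 \<le> \<lfloor>radix_rem J t k * real (J k)\<rfloor>" by simp
  then show ?thesis by (simp add: radix_digit_def radix_rem.simps(2) frac_def)
qed

lemma radix_digit_less:
  assumes "t \<in> {0..<1}" "0 < J k"
  shows "radix_digit J t k < J k"
proof -
  have "radix_rem J t k * real (J k) < real (J k)"
    using radix_rem_Ico[OF assms(1), of J k] assms(2) by simp
  then have "real (radix_digit J t k) < real (J k)"
    using radix_digit_rem[OF assms(1), of J k] radix_rem_Ico[OF assms(1), of J "Suc k"]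
    unfolding atLeastLessThan_iff by linarith
  then show ?thesis by simp
qed

text \<open>Equal digits cancel, so each step merely multiplies the difference of the remainders by
  the current base.\<close>

lemma radix_diff:
  assumes "t \<in> {0..<1}" "u \<in> {0..<1}" "\<And>i. 0 < J i" "\<And>i. i < k \<Longrightarrow> radix_digit J t i = radix_digit J u i"
  shows "(\<Prod>i<k. real (J i)) * (t - u) = radix_rem J t k - radix_rem J u k"
  using assms(4)
proof (induction k)
  case (Suc k)
  then have "(\<Prod>i<Suc k. real (J i)) * (t - u) = (radix_rem J t k - radix_rem J u k) * J k"
    by simp
  also have "\<dots> = radix_rem J t k * J k - radix_rem J u k * J k" by (simp add: algebra_simps)
  also have "\<dots> = radix_rem J t (Suc k) - radix_rem J u (Suc k)"
    using Suc.prems[of k] unfolding radix_digit_rem[OF assms(1)] radix_digit_rem[OF assms(2)] by simp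
  finally show ?case .
qed simp

text \<open>If all digits agreed, the difference scaled by at least \<open>2 ^ k\<close> would stay
  below 1 for every \<open>k\<close>.\<close>

lemma radix_digit_differ:
  assumes "t \<in> {0..<1}" "u \<in> {0..<1}" "\<And>i. 2 \<le> J i" "t \<noteq> u"
  shows "\<exists>k. radix_digit J t k \<noteq> radix_digit J u k \<and> (\<forall>i<k. radix_digit J t i = radix_digit J u i)"
proof -
  have "\<exists>k. radix_digit J t k \<noteq> radix_digit J u k"
  proof (rule ccontr)
    assume "\<not> ?thesis"
    then have eq: "\<And>i. radix_digit J t i = radix_digit J u i" by blast
    obtain k where k: "1 / \<bar>t - u\<bar> < 2 ^ k" using real_arch_pow[of 2] by force
    have "2 ^ k \<le> (\<Prod>i<k. real (J i))"
      using assms(3) prod_mono[of "{..<k}" "\<lambda>_. 2::real" "\<lambda>i. real (J i)"]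
      by (simp add: numeral_le_real_of_nat_iff)
    then have "2 ^ k * \<bar>t - u\<bar> \<le> \<bar>(\<Prod>i<k. real (J i)) * (t - u)\<bar>"
      unfolding abs_mult by (intro mult_right_mono) auto
    also have "\<dots> = \<bar>radix_rem J t k - radix_rem J u k\<bar>"
    proof -
      have "0 < J i" for i using assms(3)[of i] by simp
      then show ?thesis using radix_diff[OF assms(1,2), of J k] eq by simp
    qed
    also have "\<dots> < 1" using radix_rem_Ico[OF assms(1), of J k] radix_rem_Ico[OF assms(2), of J k] by auto
    finally show False using k assms(4) by (simp add: field_simps)
  qed
  then show ?thesis
    using exists_least_iff[of "\<lambda>k. radix_digit J t k \<noteq> radix_digit J u k"] by auto
qed

text \<open>The map taking a mixed radix expansion to a Cantor series with the same digits has an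
  \<open>s\<close>-Hoelder inverse; \<open>J k * \<eta> k\<close> is the length of a level-\<open>k\<close> interval of the Cantor set and the
  product counts these intervals.\<close>
lemma radix_series_inverse_hoelder:
  fixes \<eta> :: "nat \<Rightarrow> real"
  defines "G \<equiv> \<lambda>J t. \<Sum>k. (1 + real (radix_digit J t k)) * \<eta> k"
  assumes J: "\<And>k. 2 \<le> J k" and \<eta>: "\<And>k. 0 < \<eta> k"
    and sm: "summable (\<lambda>k. real (J k) * \<eta> k)"
    and tail: "\<And>k. (\<Sum>i. real (J (i + Suc k)) * \<eta> (i + Suc k)) \<le> \<eta> k / 2"
    and s: "0 \<le> s" "s \<le> 1" and c: "0 < c"
    and count: "\<And>k. c \<le> (\<Prod>i<k. real (J i)) * (real (J k) * \<eta> k) powr s"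
    and tu: "t \<in> {0..<1}" "u \<in> {0..<1}"
  shows "\<bar>t - u\<bar> \<le> (4 powr s / c) * \<bar>G J t - G J u\<bar> powr s"
proof (cases "t = u")
  case True
  then show ?thesis using c by simp
next
  case False
  obtain k where k: "radix_digit J t k \<noteq> radix_digit J u k"
    "\<And>i. i < k \<Longrightarrow> radix_digit J t i = radix_digit J u i"
    using radix_digit_differ[where J = J, OF tu J False] by metis
  have Jpos: "0 < J i" for i using J[of i] by simp
  have dig: "1 + real (radix_digit J v i) \<le> real (J i)" if "v \<in> {0..<1}" for v i
    using radix_digit_less[of v J i] that Jpos[of i] by linarith
  have smv: "summable (\<lambda>k. (1 + real (radix_digit J v k)) * \<eta> k)" if "v \<in> {0..<1}" for v
    by (rule summable_comparison_test'[OF sm, of 0])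
      (use dig[OF that] \<eta> in \<open>auto simp: abs_mult less_imp_le intro!: mult_right_mono\<close>)
  define a where "a = (\<lambda>i. real (radix_digit J t i) - real (radix_digit J u i))"
  have a_le: "\<bar>a i\<bar> \<le> real (J i)" for i
    using dig[OF tu(1), of i] dig[OF tu(2), of i] by (simp add: a_def)
  have a0: "a i = 0" if "i < k" for i using k(2)[OF that] by (simp add: a_def)
  have ak: "1 \<le> \<bar>a k\<bar>" using k(1) by (simp add: a_def)
  have sa: "(\<lambda>i. a i * \<eta> i) sums (G J t - G J u)"
    using sums_diff[OF smv[OF tu(1), THEN summable_sums] smv[OF tu(2), THEN summable_sums]]
    by (simp add: G_def a_def algebra_simps)
  \<comment> \<open>The first differing digit contributes at least \<open>\<eta> k\<close>, twice
    the bound for everything after it, so half of its contribution survives.\<close>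
  have Gdiff: "\<bar>a k\<bar> * \<eta> k / 2 \<le> \<bar>G J t - G J u\<bar>"
  proof -
    have "G J t - G J u = (\<Sum>i. a (i + Suc k) * \<eta> (i + Suc k)) + (\<Sum>i<Suc k. a i * \<eta> i)"
      using sa suminf_split_initial_segment[of "\<lambda>i. a i * \<eta> i" "Suc k"] by (simp add: sums_iff)
    also have "(\<Sum>i<Suc k. a i * \<eta> i) = a k * \<eta> k" using a0 by simp
    finally have eq: "G J t - G J u = (\<Sum>i. a (i + Suc k) * \<eta> (i + Suc k)) + a k * \<eta> k" .
    have smt: "summable (\<lambda>i. real (J (i + Suc k)) * \<eta> (i + Suc k))"
      using sm by (subst summable_iff_shift)
    have "norm (\<Sum>i. a (i + Suc k) * \<eta> (i + Suc k)) \<le> (\<Sum>i. real (J (i + Suc k)) * \<eta> (i + Suc k))"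
      using a_le \<eta> by (intro norm_suminf_le[OF _ smt])
        (auto simp: abs_mult less_imp_le intro!: mult_right_mono)
    also have "\<dots> \<le> \<eta> k / 2" by (rule tail)
    also have "\<dots> \<le> \<bar>a k * \<eta> k\<bar> / 2"
      using ak \<eta>[of k] by (simp add: abs_mult)
    finally have "\<bar>a k * \<eta> k\<bar> / 2 \<le> \<bar>G J t - G J u\<bar>" unfolding eq by (simp only: real_norm_def)
    then show ?thesis using \<eta>[of k] by (simp add: abs_mult)
  qed
  \<comment> \<open>This is the distance of \<open>t\<close> and \<open>u\<close> magnified by the
    product \<open>P\<close> of the first \<open>k\<close> bases. It is at most 1, so at the end it
    may be replaced by its \<open>s\<close>-th power.\<close>
  define x where "x = \<bar>radix_rem J t k - radix_rem J u k\<bar>"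
  define P where "P = (\<Prod>i<k. real (J i))"
  have P: "0 < P" unfolding P_def using Jpos by (intro prod_pos) auto
  have x1: "0 \<le> x" "x \<le> 1"
    using radix_rem_Ico[OF tu(1), of J k] radix_rem_Ico[OF tu(2), of J k] by (auto simp: x_def)
  have "x * real (J k) = \<bar>radix_rem J t k * real (J k) - radix_rem J u k * real (J k)\<bar>"
    by (simp add: x_def left_diff_distrib[symmetric] abs_mult)
  also have "\<dots> \<le> \<bar>a k\<bar> + 1"
    unfolding radix_digit_rem[OF tu(1)] radix_digit_rem[OF tu(2)] a_def
    using radix_rem_Ico[OF tu(1), of J "Suc k"] radix_rem_Ico[OF tu(2), of J "Suc k"]
    unfolding atLeastLessThan_iff by linarith
  also have "\<dots> \<le> 2 * \<bar>a k\<bar>" using ak by simp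
  also have "\<dots> = 4 * (\<bar>a k\<bar> * \<eta> k / 2) / \<eta> k" using \<eta>[of k] by simp
  also have "\<dots> \<le> 4 * \<bar>G J t - G J u\<bar> / \<eta> k"
    using \<eta>[of k] by (intro divide_right_mono mult_left_mono Gdiff) auto
  finally have "x \<le> 4 * \<bar>G J t - G J u\<bar> / (real (J k) * \<eta> k)"
    using Jpos[of k] \<eta>[of k] by (simp add: field_simps)
  then have "x powr s \<le> (4 * \<bar>G J t - G J u\<bar> / (real (J k) * \<eta> k)) powr s"
    using x1 s by (intro powr_mono2) auto
  also have "\<dots> = 4 powr s * \<bar>G J t - G J u\<bar> powr s / (real (J k) * \<eta> k) powr s"
    using \<eta>[of k] by (simp add: powr_divide powr_mult)
  also have "\<dots> \<le> 4 powr s * \<bar>G J t - G J u\<bar> powr s * (P / c)"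
  proof -
    have "0 < (real (J k) * \<eta> k) powr s" using \<eta>[of k] Jpos[of k] by simp
    then have "1 / (real (J k) * \<eta> k) powr s \<le> P / c"
      using count[of k] c by (simp add: P_def field_simps)
    then have "4 powr s * \<bar>G J t - G J u\<bar> powr s * (1 / (real (J k) * \<eta> k) powr s)
        \<le> 4 powr s * \<bar>G J t - G J u\<bar> powr s * (P / c)" by (intro mult_left_mono) auto
    then show ?thesis by simp
  qed
  finally have "x powr s \<le> P * ((4 powr s / c) * \<bar>G J t - G J u\<bar> powr s)" by (simp add: mult_ac)
  moreover have "x \<le> x powr s" using powr_mono'[OF s(2), of x] x1 by simp
  moreover have "P * \<bar>t - u\<bar> = x"
  proof -
    have "P * (t - u) = radix_rem J t k - radix_rem J u k"
      unfolding P_def by (rule radix_diff[where J = J and k = k, OF tu Jpos k(2)])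
    then have "x = \<bar>P * (t - u)\<bar>" by (simp only: x_def)
    then show ?thesis using P by (simp add: abs_mult)
  qed
  ultimately have "P * \<bar>t - u\<bar> \<le> P * ((4 powr s / c) * \<bar>G J t - G J u\<bar> powr s)" by linarith
  then show ?thesis by (simp only: mult_le_cancel_left_pos[OF P])
qed

section \<open>Lacunary sequences of convergents\<close>

text \<open>If \<psi> were beaten only finitely often, then \<open>\<psi> x \<le> T n\<close> would
  hold for large \<open>n\<close> and all \<open>x\<close> beyond \<open>B n\<close>. The range
  between \<open>B n\<close> and \<open>B (Suc n)\<close> would contribute at most
  \<open>B (Suc n) * T n\<close>, and \<psi> would be summable.\<close>

lemma Omega11_I:
  fixes R :: "nat \<Rightarrow> int" and B T :: "nat \<Rightarrow> real"
  assumes \<alpha>: "\<alpha> \<in> {0..<1}" and \<gamma>: "\<gamma> \<in> {0..<1}"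
    and B: "\<And>n. \<bar>of_int (R n)\<bar> \<le> B n" and T: "\<And>n. dnint (of_int (R n) * \<alpha> - \<gamma>) \<le> T n"
    and R: "filterlim (\<lambda>n. \<bar>real_of_int (R n)\<bar>) at_top sequentially"
    and sm: "summable (\<lambda>n. B (Suc n) * T n)"
  shows "\<gamma> \<in> Omega11 \<alpha>"
proof -
  have T0: "0 \<le> T n" for n using dnint_nonneg T[of n] by (rule order_trans)
  have B0: "0 \<le> B n" for n using B[of n] by linarith
  have Btop: "filterlim B at_top sequentially"
    by (rule filterlim_at_top_mono[OF R]) (use B in auto)
  have "(\<alpha>, \<gamma>) \<in> W11 \<psi>" if \<psi>: "\<psi> \<in> Dclass" for \<psi>
  proof (rule ccontr)
    assume "(\<alpha>, \<gamma>) \<notin> W11 \<psi>"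
    then have fin: "finite {q::int. dnint (of_int q * \<alpha> - \<gamma>) < \<psi> (nat \<bar>q\<bar>)}"
      using \<alpha> \<gamma> by (simp add: W11_def)
    have \<psi>0: "0 \<le> \<psi> n" if "1 \<le> n" for n using \<psi> that by (auto simp: Dclass_def)
    have \<psi>m: "\<psi> n \<le> \<psi> m" if "1 \<le> m" "m \<le> n" for m n using \<psi> that by (auto simp: Dclass_def)
    obtain n0 :: int where n0: "\<And>q. n0 < \<bar>q\<bar> \<Longrightarrow> \<psi> (nat \<bar>q\<bar>) \<le> dnint (of_int q * \<alpha> - \<gamma>)"
    proof -
      have "bdd_above (abs ` {q::int. dnint (of_int q * \<alpha> - \<gamma>) < \<psi> (nat \<bar>q\<bar>)})"
        using fin by (intro bdd_above_finite finite_imageI)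
      then obtain b where "\<And>q::int. dnint (of_int q * \<alpha> - \<gamma>) < \<psi> (nat \<bar>q\<bar>) \<Longrightarrow> \<bar>q\<bar> \<le> b"
        by (auto simp: bdd_above_def)
      then show ?thesis using that[of b] by (meson not_le)
    qed
    have "eventually (\<lambda>n. real_of_int (max n0 1) < \<bar>of_int (R n)\<bar>) sequentially"
      using R unfolding filterlim_at_top_dense by blast
    then obtain M where M: "\<And>n. M \<le> n \<Longrightarrow> real_of_int (max n0 1) < \<bar>of_int (R n)\<bar>"
      by (auto simp: eventually_sequentially)
    have \<psi>T: "\<psi> x \<le> T n" if n: "M \<le> n" and x: "B n \<le> real x" for n x
    proof -
      have R1: "n0 < \<bar>R n\<bar>" "1 < \<bar>R n\<bar>" using M[OF n] by linarith+
      have "\<bar>R n\<bar> \<le> int x" using B[of n] x by linarith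
      then have "\<psi> x \<le> \<psi> (nat \<bar>R n\<bar>)" using R1 by (intro \<psi>m) linarith+
      also have "\<dots> \<le> T n" using n0[OF R1(1)] T[of n] by linarith
      finally show ?thesis .
    qed
    define c where "c = (\<lambda>b X. card {i. i < X \<and> real (Suc i) < b})"
    have c_le: "real (c b X) \<le> b" if "0 \<le> b" for b X
    proof -
      have "{i. i < X \<and> real (Suc i) < b} \<subseteq> {..<nat \<lfloor>b\<rfloor>}"
        by (auto simp: less_floor_iff zless_nat_eq_int_zless) 
      then have "c b X \<le> nat \<lfloor>b\<rfloor>" unfolding c_def using card_mono[of "{..<nat \<lfloor>b\<rfloor>}"] by fastforce
      then show ?thesis using that by linarith
    qed
    have ind: "(\<Sum>i<X. if real (Suc i) < b then y else 0) = real (c b X) * y" for b y :: real and X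
      unfolding c_def by (subst sum.inter_filter[symmetric]) (auto intro!: arg_cong[where f = card])
    have "summable (\<lambda>n. \<psi> (Suc n))"
    proof (rule summableI_nonneg_bounded)
      show "0 \<le> \<psi> (Suc n)" for n by (rule \<psi>0) simp
      fix X
      have "eventually (\<lambda>n. real X < B n \<and> M < n) sequentially"
        using Btop unfolding filterlim_at_top_dense
        by (intro eventually_conj eventually_gt_at_top) auto
      then obtain Y where Y: "real X < B Y" "M < Y" by (auto simp: eventually_sequentially)
      \<comment> \<open>Since \<open>B\<close> need not be monotone, the block of
        \<open>Suc i\<close> is found through the least index from \<open>M\<close> on whose
        \<open>B\<close> exceeds \<open>Suc i\<close>; its predecessor supplies the bound by
        \<open>T\<close>. Indices below \<open>B M\<close> are charged to
        \<open>\<psi> 1\<close>.\<close>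
      have pt: "\<psi> (Suc i) \<le> (if real (Suc i) < B M then \<psi> 1 else 0) +
          (\<Sum>n<Y. if real (Suc i) < B (Suc n) then T n else 0)" if "i < X" for i
      proof (cases "real (Suc i) < B M")
        case True
        have "0 \<le> (\<Sum>n<Y. if real (Suc i) < B (Suc n) then T n else 0)"
          using T0 by (intro sum_nonneg) auto
        then show ?thesis using True \<psi>m[of 1 "Suc i"] by simp
      next
        case False
        have "real (Suc i) < B (M + (Y - M))" using that Y by simp
        then obtain m where m: "real (Suc i) < B (M + m)" "\<And>j. j < m \<Longrightarrow> \<not> real (Suc i) < B (M + j)"
          using exists_least_iff[of "\<lambda>m. real (Suc i) < B (M + m)"] by blast
        have "m \<noteq> 0" using False m(1) by (intro notI) simp
        then obtain l where l: "m = Suc l" by (cases m) auto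
        have "\<not> Y - M < m" using m(2)[of "Y - M"] \<open>real (Suc i) < B (M + (Y - M))\<close> by blast
        then have lY: "M + l < Y" using l Y(2) by linarith
        have "\<psi> (Suc i) \<le> T (M + l)" using m(2)[of l] l by (intro \<psi>T) auto
        also have "\<dots> = (if real (Suc i) < B (Suc (M + l)) then T (M + l) else 0)" using m(1) l by simp
        also have "\<dots> \<le> (\<Sum>n<Y. if real (Suc i) < B (Suc n) then T n else 0)"
          using T0 lY by (intro member_le_sum) auto
        finally show ?thesis using False by simp
      qed
      have "(\<Sum>i<X. \<psi> (Suc i)) \<le> (\<Sum>i<X. (if real (Suc i) < B M then \<psi> 1 else 0) +
          (\<Sum>n<Y. if real (Suc i) < B (Suc n) then T n else 0))"
        using pt by (intro sum_mono) auto
      also have "\<dots> = real (c (B M) X) * \<psi> 1 + (\<Sum>n<Y. real (c (B (Suc n)) X) * T n)"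
        unfolding sum.distrib ind by (subst sum.swap) (simp only: ind)
      also have "\<dots> \<le> B M * \<psi> 1 + (\<Sum>n<Y. B (Suc n) * T n)"
        using T0 B0 c_le \<psi>0[of 1] by (intro add_mono sum_mono mult_right_mono) auto
      also have "\<dots> \<le> B M * \<psi> 1 + (\<Sum>n. B (Suc n) * T n)"
        using T0 B0 by (intro add_left_mono sum_le_suminf[OF sm]) auto
      finally show "(\<Sum>i<X. \<psi> (Suc i)) \<le> B M * \<psi> 1 + (\<Sum>n. B (Suc n) * T n)" .
    qed
    then show False using \<psi> by (simp add: Dclass_def)
  qed
  then show ?thesis using \<gamma> by (simp add: Omega11_def)
qed

lemma card_ints_near:
  fixes x y :: real
  assumes "0 \<le> y"
  shows "finite {j::int. \<bar>of_int j - x\<bar> \<le> y}" "real (card {j::int. \<bar>of_int j - x\<bar> \<le> y}) \<le> 2 * y + 1"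
proof -
  have sub: "{j::int. \<bar>of_int j - x\<bar> \<le> y} \<subseteq> {\<lceil>x - y\<rceil>..\<lfloor>x + y\<rfloor>}"
    by (auto simp: le_floor_iff ceiling_le_iff)
  then show "finite {j::int. \<bar>of_int j - x\<bar> \<le> y}" by (rule finite_subset) simp
  have "card {j::int. \<bar>of_int j - x\<bar> \<le> y} \<le> card {\<lceil>x - y\<rceil>..\<lfloor>x + y\<rfloor>}"
    by (rule card_mono[OF _ sub]) simp
  then show "real (card {j::int. \<bar>of_int j - x\<bar> \<le> y}) \<le> 2 * y + 1"
    using assms by simp linarith
qed

lemma powr_floor_bounds:
  assumes "2 \<le> (x::real)"
  shows "real (nat \<lfloor>x\<rfloor>) \<le> x" "x / 2 \<le> real (nat \<lfloor>x\<rfloor>)" "2 \<le> nat \<lfloor>x\<rfloor>"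
  using assms by linarith+

text \<open>This isolates what is needed from continued fractions: coprimality and two-sided error
  bounds, without the recurrence. \<open>growth\<close> is the liminf hypothesis in eventual
  form.\<close>

locale lacunary_convergents =
  fixes \<alpha> lam :: real and p q :: "nat \<Rightarrow> int"
  assumes alpha: "\<alpha> \<in> {0..<1}"
    and q_pos: "1 \<le> q k" and q_mono: "q k \<le> q (Suc k)"
    and q_top: "filterlim (\<lambda>k. real_of_int (q k)) at_top sequentially"
    and coprime_p_q: "coprime (p k) (q k)"
    and theta_le: "\<bar>of_int (q k) * \<alpha> - of_int (p k)\<bar> \<le> 1 / of_int (q (Suc k))"
    and theta_ge: "1 / (2 * of_int (q (Suc k))) \<le> \<bar>of_int (q k) * \<alpha> - of_int (p k)\<bar>"
    and lam: "1 < lam"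
    and growth: "eventually (\<lambda>k. of_int (q k) powr lam \<le> real_of_int (q (Suc k))) sequentially"
begin

definition rho :: "nat \<Rightarrow> real" where "rho k = of_int (q (Suc k)) / of_int (q k)"

lemma q_pos_real: "1 \<le> real_of_int (q k)"
  using q_pos[of k] by simp

lemma rho_pos: "0 < rho k"
  using q_pos_real[of k] q_pos_real[of "Suc k"] by (simp add: rho_def)

lemma rho_ge: "eventually (\<lambda>k. of_int (q k) powr (lam - 1) \<le> rho k) sequentially"
  using growth
proof eventually_elim
  case (elim k)
  have "real_of_int (q k) powr (lam - 1) = of_int (q k) powr lam / of_int (q k)"
    using q_pos_real[of k] by (simp add: powr_diff)
  also have "\<dots> \<le> rho k" unfolding rho_def using elim q_pos_real[of k] by (intro divide_right_mono) auto
  finally show ?case .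
qed

lemma q_powr_top: "0 < a \<Longrightarrow> filterlim (\<lambda>k. real_of_int (q k) powr a) at_top sequentially"
  by (rule filterlim_compose[OF _ q_top]) real_asymp

lemma rho_top: "filterlim rho at_top sequentially"
  by (rule filterlim_at_top_mono[OF q_powr_top[of "lam - 1"]]) (use lam rho_ge in auto)

text \<open>Used to absorb constant factors into an arbitrarily small power of
  \<open>rho k\<close>.\<close>

lemma rho_powr_large:
  assumes "0 < a"
  shows "eventually (\<lambda>k. C \<le> rho k powr a) sequentially"
proof -
  have "filterlim (\<lambda>x::real. x powr a) at_top at_top" using assms by real_asymp
  then have "filterlim (\<lambda>k. rho k powr a) at_top sequentially"
    using rho_top by (rule filterlim_compose)
  then show ?thesis by (simp add: filterlim_at_top)
qed

section \<open>Lower bound in the lacunary case: a Cantor set of good points\<close>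

lemma Omega11_measure_nonzero:
  assumes s: "0 < s" "s \<le> 1" and v: "0 < v" "v < 1/2" and w: "0 < w"
    and vs: "s * (w * (1 - v) + v) < v"
    and qw: "eventually (\<lambda>k. real_of_int (q (Suc k)) \<le> of_int (q k) powr w) sequentially"
    and t: "0 \<le> t" "t \<le> s"
  shows "hausdorff_measure t (Omega11 \<alpha>) \<noteq> 0"
proof -
  \<comment> \<open>A level-\<open>k\<close> interval has length about \<open>E k\<close>, at least
    \<open>Q k powr (- (w * (1 - v) + v))\<close>, so its \<open>s\<close>-th power is at least a
    constant times \<open>Q k powr (- v')\<close>. The gap \<open>v' < v\<close> absorbs the factor
    2 lost in rounding the number of digits down.\<close>
  define v' where "v' = s * (w * (1 - v) + v)"
  have v': "0 < v'" "v' < v"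
    using vs s v w by (auto simp: v'_def intro!: mult_pos_pos add_pos_pos)
  have "eventually (\<lambda>k. 2 \<le> rho k \<and> 2 \<le> rho k powr v \<and> 8 \<le> rho k powr (1 - v) \<and> 2 \<le> rho k powr (v - v')
      \<and> of_int (q k) powr (lam - 1) \<le> rho k \<and> real_of_int (q (Suc k)) \<le> of_int (q k) powr w) sequentially"
    using rho_powr_large[of 1 2] rho_powr_large[of v 2] rho_powr_large[of "1 - v" 8]
      rho_powr_large[of "v - v'" 2] rho_ge qw v v' rho_pos
    by (simp add: eventually_conj_iff less_imp_le)
  then obtain K where K: "\<And>k. K \<le> k \<Longrightarrow> 2 \<le> rho k \<and> 2 \<le> rho k powr v \<and> 8 \<le> rho k powr (1 - v) \<and>
      2 \<le> rho k powr (v - v') \<and> of_int (q k) powr (lam - 1) \<le> rho k \<and>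
      real_of_int (q (Suc k)) \<le> of_int (q k) powr w"
    by (auto simp: eventually_sequentially)
  \<comment> \<open>Everything is shifted by \<open>K\<close>, so that the eventual estimates hold
    from index 0. Below, \<open>E i\<close> bounds the contribution of digit \<open>i\<close> to the
    point, and \<open>F i\<close> bounds its contribution to the multiplier of \<alpha>.\<close>
  define Q where "Q = (\<lambda>i. real_of_int (q (K + i)))"
  define r where "r = (\<lambda>i. rho (K + i))"
  define th where "th = (\<lambda>i. Q i * \<alpha> - of_int (p (K + i)))"
  define h where "h = (\<lambda>i. \<bar>th i\<bar>)"
  define J where "J = (\<lambda>i. nat \<lfloor>r i powr v\<rfloor>)"
  define E where "E = (\<lambda>i. r i powr v / Q (Suc i))"
  define F where "F = (\<lambda>i. r i powr v * Q i)"
  have Q1: "1 \<le> Q i" for i using q_pos_real by (simp add: Q_def)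
  have Qpos: "0 < Q i" for i using Q1[of i] by linarith
  have rQ: "r i = Q (Suc i) / Q i" for i by (simp add: r_def Q_def rho_def)
  have r: "2 \<le> r i" "2 \<le> r i powr v" "8 \<le> r i powr (1 - v)" "2 \<le> r i powr (v - v')"
    "Q i powr (lam - 1) \<le> r i" "Q (Suc i) \<le> Q i powr w" for i
    using K[of "K + i"] by (simp_all add: r_def Q_def)
  have h_le: "h i \<le> 1 / Q (Suc i)" and h_ge: "1 / (2 * Q (Suc i)) \<le> h i" for i
    using theta_le[of "K + i"] theta_ge[of "K + i"] by (simp_all add: h_def th_def Q_def)
  have hpos: "0 < h i" for i
    by (rule less_le_trans[OF _ h_ge]) (use Qpos[of "Suc i"] in simp)
  have J_le: "real (J i) \<le> r i powr v" and J_ge: "r i powr v / 2 \<le> real (J i)" and J2: "2 \<le> J i" for i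
    using powr_floor_bounds[OF r(2)] by (simp_all add: J_def)
  have Epos: "0 < E i" for i using Qpos[of "Suc i"] r(1)[of i] by (simp add: E_def)
  have Fpos: "0 < F i" for i using Qpos[of i] r(1)[of i] by (simp add: F_def)
  have JhE: "real (J i) * h i \<le> E i" for i
    using mult_mono[OF J_le h_le, of i i] hpos[of i] r(2)[of i] by (simp add: E_def less_imp_le)
  have EJh: "E i / 4 \<le> real (J i) * h i" for i
    using mult_mono[OF J_ge h_ge, of i i] Qpos[of "Suc i"] by (simp add: E_def mult_ac)
  have rv: "r i powr v * r i powr (1 - v) = r i" for i
    using r(1)[of i] by (simp flip: powr_add)
  have Er: "E i * r i powr (1 - v) = 1 / Q i" for i
    using rv[of i] Qpos[of i] Qpos[of "Suc i"] by (simp add: E_def rQ)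
  \<comment> \<open>The constant 8 gives \<open>E (Suc i) \<le> h i / 4\<close>. The tail after
    level \<open>i\<close> is at most \<open>2 * E (Suc i)\<close>, which is then the
    \<open>h i / 2\<close> demanded by the Hoelder estimate.\<close>
  have E8: "E i \<le> 1 / Q i / 8" for i
    using mult_left_mono[OF r(3), of "E i" i] Epos[of i] by (simp add: Er)
  have Eh: "E (Suc i) \<le> h i / 4" for i
    using E8[of "Suc i"] h_ge[of i] by simp
  have E_half: "E (Suc i) \<le> E i / 2" for i
  proof -
    have "E (Suc i) \<le> 1 / Q (Suc i) / 8" by (rule E8)
    also have "\<dots> \<le> r i powr v / Q (Suc i) / 2"
      using r(2)[of i] Qpos[of "Suc i"] by (simp add: divide_simps)
    finally show ?thesis by (simp add: E_def)
  qed
  have E_geom: "E (i + m) \<le> E m * (1/2) ^ i" for i m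
  proof (induction i)
    case (Suc i)
    then show ?case using E_half[of "i + m"] by simp
  qed simp
  have geom: "summable (\<lambda>i. E m * (1/2) ^ i)" "(\<Sum>i. E m * (1/2) ^ i) = 2 * E m" for m
    by (auto simp: suminf_mult suminf_geometric intro!: summable_mult summable_geometric)
  have tailJ: "summable (\<lambda>i. a (i + m) * h (i + m)) \<and> (\<Sum>i. a (i + m) * h (i + m)) \<le> 2 * E m
      \<and> 0 \<le> (\<Sum>i. a (i + m) * h (i + m))"
    if a: "\<And>i. 0 \<le> a i" "\<And>i. a i \<le> real (J i)" for a :: "nat \<Rightarrow> real" and m
  proof -
    have le: "a i * h i \<le> E i" for i
      using mult_right_mono[OF a(2)[of i], of "h i"] hpos[of i] JhE[of i] by linarith
    have le2: "a (i + m) * h (i + m) \<le> E m * (1/2) ^ i" for i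
      using le[of "i + m"] E_geom[of i m] by linarith
    have nn: "0 \<le> a i * h i" for i using a(1)[of i] hpos[of i] by simp
    have sm: "summable (\<lambda>i. a (i + m) * h (i + m))"
      by (rule summable_comparison_test'[OF geom(1)[of m], of 0]) (use nn le2 in auto)
    show ?thesis using suminf_le[OF le2 sm geom(1)] geom(2)[of m] suminf_nonneg[OF sm] nn sm by auto
  qed
  define G where "G = (\<lambda>t. \<Sum>k. (1 + real (radix_digit J t k)) * h k)"
  have hoelder: "\<exists>c>0. \<forall>t\<in>{0..<1}. \<forall>u\<in>{0..<1}. \<bar>t - u\<bar> \<le> (4 powr s / c) * \<bar>G t - G u\<bar> powr s"
  proof -
    define c where "c = Q 0 powr (- v') * 4 powr (- s)"
    have c: "0 < c" using Qpos[of 0] by (simp add: c_def)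
    have N: "(Q k / Q 0) powr v' \<le> (\<Prod>i<k. real (J i))" for k
    proof (induction k)
      case 0
      then show ?case using Qpos[of 0] by simp
    next
      case (Suc k)
      have "r k powr v' * 2 \<le> r k powr v' * r k powr (v - v')"
        by (rule mult_left_mono[OF r(4)]) simp
      also have "\<dots> = r k powr v" using r(1)[of k] by (simp flip: powr_add)
      finally have "r k powr v' \<le> real (J k)" using J_ge[of k] by simp
      with Suc have "(Q k / Q 0) powr v' * r k powr v' \<le> (\<Prod>i<k. real (J i)) * real (J k)"
        by (intro mult_mono) (auto intro!: prod_nonneg)
      moreover have "(Q k / Q 0) powr v' * r k powr v' = (Q (Suc k) / Q 0) powr v'"
        using Qpos[of k] Qpos[of 0] Qpos[of "Suc k"] by (simp add: rQ flip: powr_mult)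
      ultimately show ?case by simp
    qed
    have count: "c \<le> (\<Prod>i<k. real (J i)) * (real (J k) * h k) powr s" for k
    proof -
      \<comment> \<open>The exponent \<open>v - 1\<close> is negative, so the upper bound on
        \<open>Q (Suc k)\<close> becomes a lower bound on \<open>E k\<close>.\<close>
      have "E k = Q (Suc k) powr (v - 1) * Q k powr (- v)"
        using Qpos[of k] Qpos[of "Suc k"]
        by (simp add: E_def rQ powr_divide powr_diff powr_minus divide_simps)
      moreover have "(Q k powr w) powr (v - 1) \<le> Q (Suc k) powr (v - 1)"
        using r(6)[of k] v Qpos[of "Suc k"] by (intro powr_mono2') auto
      ultimately have "(Q k powr w) powr (v - 1) * Q k powr (- v) \<le> E k"
        by (simp add: mult_right_mono)
      then have "Q k powr (w * (v - 1) - v) \<le> E k"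
        by (simp add: powr_powr flip: powr_add)
      then have "(Q k powr (w * (v - 1) - v)) powr s \<le> E k powr s"
        using s by (intro powr_mono2) auto
      then have "Q k powr (- v') \<le> E k powr s"
        by (simp add: powr_powr v'_def algebra_simps)
      then have "Q k powr (- v') * 4 powr (- s) \<le> E k powr s * 4 powr (- s)"
        by (rule mult_right_mono) simp
      also have "\<dots> = (E k / 4) powr s"
        using Epos[of k] by (simp add: powr_divide powr_minus_divide)
      also have "\<dots> \<le> (real (J k) * h k) powr s"
        using s EJh[of k] Epos[of k] by (intro powr_mono2) auto
      finally have "Q k powr (- v') * 4 powr (- s) \<le> (real (J k) * h k) powr s" .
      then have "(Q k / Q 0) powr v' * (Q k powr (- v') * 4 powr (- s))
          \<le> (\<Prod>i<k. real (J i)) * (real (J k) * h k) powr s"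
        by (intro mult_mono[OF N]) (auto intro!: prod_nonneg)
      moreover have "(Q k / Q 0) powr v' * (Q k powr (- v') * 4 powr (- s)) = c"
        using Qpos[of k] Qpos[of 0] by (simp add: c_def powr_divide powr_minus divide_simps)
      ultimately show ?thesis by simp
    qed
    have tail: "(\<Sum>i. real (J (i + Suc k)) * h (i + Suc k)) \<le> h k / 2" for k
      using tailJ[of "\<lambda>i. real (J i)" "Suc k"] Eh[of k] by simp
    have smJ: "summable (\<lambda>k. real (J k) * h k)"
      using tailJ[of "\<lambda>i. real (J i)" 0] by simp
    show ?thesis
      unfolding G_def using s
      by (intro exI[of _ c] conjI c ballI radix_series_inverse_hoelder J2 hpos smJ tail count) auto
  qed
  have G_Omega: "G x \<in> Omega11 \<alpha>" if x: "x \<in> {0..<1}" for x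
  proof -
    \<comment> \<open>The shift by 1 makes every digit positive, which keeps the multipliers
      \<open>R n\<close> growing.\<close>
    define a where "a = (\<lambda>i. 1 + radix_digit J x i)"
    have a: "1 \<le> a i" "a i \<le> J i" for i
      using radix_digit_less[OF x, of J i] J2[of i] by (auto simp: a_def)
    have Ga: "G x = (\<Sum>i. real (a i) * h i)" by (simp add: G_def a_def)
    have tail: "summable (\<lambda>i. real (a (i + m)) * h (i + m)) \<and> (\<Sum>i. real (a (i + m)) * h (i + m)) \<le> 2 * E m
      \<and> 0 \<le> (\<Sum>i. real (a (i + m)) * h (i + m))" for m
      using tailJ[of "\<lambda>i. real (a i)" m] a by simp
    \<comment> \<open>The signs turn each error into its absolute value, so that the partial sums of
      the series are multiples of \<alpha> modulo 1.\<close>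
    define sg where "sg = (\<lambda>i. if 0 \<le> th i then 1 else -1 :: int)"
    define R where "R = (\<lambda>n. \<Sum>i<n. sg i * int (a i) * q (K + i))"
    define P where "P = (\<lambda>n. \<Sum>i<n. sg i * int (a i) * p (K + i))"
    have hs: "h i = of_int (sg i) * th i" for i by (simp add: h_def sg_def)
    have partial: "of_int (R n) * \<alpha> - of_int (P n) = (\<Sum>i<n. real (a i) * h i)" for n
      unfolding R_def P_def
      by (simp add: hs th_def Q_def sum_distrib_right sum_distrib_left algebra_simps flip: sum_subtractf)
    show ?thesis
    proof (rule Omega11_I[OF alpha, of _ R "\<lambda>n. case n of 0 \<Rightarrow> 0 | Suc m \<Rightarrow> 2 * F m" "\<lambda>n. 2 * E n"])
      have "1 / Q 0 / 8 \<le> 1 / 8" using Q1[of 0] by (simp add: divide_simps)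
      then have "E 0 \<le> 1 / 8" using E8[of 0] by linarith
      then show "G x \<in> {0..<1}" using tail[of 0] by (simp add: Ga)
      show "dnint (of_int (R n) * \<alpha> - G x) \<le> 2 * E n" for n
      proof -
        have "G x = (\<Sum>i. real (a (i + n)) * h (i + n)) + (\<Sum>i<n. real (a i) * h i)"
          unfolding Ga by (rule suminf_split_initial_segment) (use tail[of 0] in simp)
        then have "\<bar>of_int (R n) * \<alpha> - G x - of_int (P n)\<bar> \<le> 2 * E n"
          using partial[of n] tail[of n] by linarith
        then show ?thesis using dnint_le[of "of_int (R n) * \<alpha> - G x" "P n"] by linarith
      qed
      have F8: "F i \<le> Q (Suc i) / 8" for i
      proof -
        have "F i * 8 \<le> F i * r i powr (1 - v)"
          by (rule mult_left_mono[OF r(3)]) (use Fpos[of i] in simp)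
        also have "\<dots> = (r i powr v * r i powr (1 - v)) * Q i" by (simp add: F_def)
        also have "\<dots> = Q (Suc i)" unfolding rv using Qpos[of i] by (simp add: rQ)
        finally show ?thesis by simp
      qed
      have QF: "Q i \<le> F i" for i
        using r(2)[of i] Qpos[of i] by (simp add: F_def)
      have step: "\<bar>real_of_int (sg i * int (a i) * q (K + i))\<bar> = real (a i) * Q i" for i
        using Qpos[of i] by (simp add: abs_mult sg_def Q_def)
      have aF: "real (a i) * Q i \<le> F i" for i
      proof -
        have "real (a i) \<le> r i powr v" using a(2)[of i] J_le[of i] by linarith
        then show ?thesis unfolding F_def using Qpos[of i] by (intro mult_right_mono) auto
      qed
      have R_le: "\<bar>real_of_int (R (Suc n))\<bar> \<le> 2 * F n" for n
      proof (induction n)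
        case 0
        then show ?case using step[of 0] aF[of 0] Fpos[of 0] by (simp add: R_def)
      next
        case (Suc n)
        have "\<bar>real_of_int (R (Suc (Suc n)))\<bar>
            \<le> \<bar>real_of_int (R (Suc n))\<bar> + \<bar>real_of_int (sg (Suc n) * int (a (Suc n)) * q (K + Suc n))\<bar>"
          unfolding R_def by (simp only: sum.lessThan_Suc[of _ "Suc n"] of_int_add)
        also have "\<dots> \<le> 2 * F n + F (Suc n)" using Suc step[of "Suc n"] aF[of "Suc n"] by linarith
        also have "\<dots> \<le> 2 * F (Suc n)" using F8[of n] QF[of "Suc n"] Fpos[of "Suc n"] by linarith
        finally show ?case .
      qed
      show "\<bar>of_int (R n)\<bar> \<le> (case n of 0 \<Rightarrow> 0 | Suc m \<Rightarrow> 2 * F m)" for n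
        using R_le by (cases n) (simp_all add: R_def)
      \<comment> \<open>The newest term has size at least \<open>Q (Suc n)\<close>, while all
        earlier terms together have at most a quarter of that.\<close>
      have R_ge: "Q (Suc n) / 2 \<le> \<bar>real_of_int (R (Suc (Suc n)))\<bar>" for n
      proof -
        have "1 * Q (Suc n) \<le> real (a (Suc n)) * Q (Suc n)"
          using a(1)[of "Suc n"] Qpos[of "Suc n"] by (intro mult_right_mono) auto
        moreover have "real_of_int (R (Suc (Suc n))) = real_of_int (R (Suc n))
            + real_of_int (sg (Suc n) * int (a (Suc n)) * q (K + Suc n))"
          unfolding R_def by (simp only: sum.lessThan_Suc[of _ "Suc n"] of_int_add)
        ultimately show ?thesis
          using step[of "Suc n"] R_le[of n] F8[of n] by linarith
      qed
      have "filterlim (\<lambda>n. K + Suc n) at_top sequentially"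
        by (rule filterlim_at_top_mono[OF filterlim_ident]) auto
      then have "filterlim (\<lambda>n. real_of_int (q (K + Suc n))) at_top sequentially"
        by (rule filterlim_compose[OF q_top])
      then have "filterlim (\<lambda>n. 1/2 * Q (Suc n)) at_top sequentially"
        unfolding Q_def by (intro filterlim_tendsto_pos_mult_at_top[OF tendsto_const]) auto
      then have "filterlim (\<lambda>n. \<bar>real_of_int (R (Suc (Suc n)))\<bar>) at_top sequentially"
        by (rule filterlim_at_top_mono) (use R_ge in auto)
      then show "filterlim (\<lambda>n. \<bar>real_of_int (R n)\<bar>) at_top sequentially"
        by (simp only: filterlim_sequentially_Suc[where f = "\<lambda>n. \<bar>real_of_int (R (Suc n))\<bar>"]
            filterlim_sequentially_Suc[where f = "\<lambda>n. \<bar>real_of_int (R n)\<bar>"])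
      show "summable (\<lambda>n. (case Suc n of 0 \<Rightarrow> 0 | Suc m \<Rightarrow> 2 * F m) * (2 * E n))"
      proof -
        \<comment> \<open>The summand is \<open>4 * r n powr (2 * v - 1)\<close>. As
          \<open>v < 1/2\<close> the exponent is negative, and \<open>r n\<close> is at least
          \<open>2 powr (n * (lam - 1))\<close>, so \<open>z\<close> is the ratio of a dominating
          geometric series.\<close>
        define z :: real where "z = 2 powr ((lam - 1) * (2 * v - 1))"
        have "z < 1" unfolding z_def using lam v by (simp add: powr_less_one mult_pos_neg)
        then have z: "0 < z" "z < 1" by (simp_all add: z_def)
        have Q2: "2 ^ n \<le> Q n" for n
        proof (induction n)
          case 0
          then show ?case using Q1[of 0] by simp
        next
          case (Suc n)
          have "Q (Suc n) = r n * Q n" using Qpos[of n] by (simp add: rQ)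
          then show ?case using mult_mono[OF r(1)[of n] Suc] r(1)[of n] by simp
        qed
        have FE: "2 * F n * (2 * E n) = 4 * r n powr (2 * v - 1)" for n
        proof -
          have "F n * E n = r n powr v * r n powr v / r n"
            using Qpos[of n] Qpos[of "Suc n"] by (simp add: F_def E_def rQ)
          also have "\<dots> = r n powr (2 * v - 1)"
            using r(1)[of n] by (simp add: powr_diff flip: powr_add)
          finally show ?thesis by simp
        qed
        have "r n powr (2 * v - 1) \<le> z ^ n" for n
        proof -
          have "(2 ^ n) powr (lam - 1) \<le> Q n powr (lam - 1)"
            using lam Q2 by (intro powr_mono2) auto
          also have "\<dots> \<le> r n" by (rule r(5))
          finally have "r n powr (2 * v - 1) \<le> ((2 ^ n) powr (lam - 1)) powr (2 * v - 1)"
            using v by (intro powr_mono2') auto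
          also have "\<dots> = z ^ n"
            by (simp add: z_def powr_powr powr_power mult_ac flip: powr_realpow)
          finally show ?thesis .
        qed
        then have "summable (\<lambda>n. 4 * r n powr (2 * v - 1))"
          using z by (intro summable_mult summable_comparison_test'[OF summable_geometric[of z], of 0]) auto
        then show ?thesis by (simp add: FE)
      qed
    qed
  qed
  obtain c where "0 < c" "\<forall>t\<in>{0..<1}. \<forall>u\<in>{0..<1}. \<bar>t - u\<bar> \<le> (4 powr s / c) * \<bar>G t - G u\<bar> powr s"
    using hoelder by blast
  then show ?thesis
    by (intro hausdorff_measure_nonzero[where L = "4 powr s / c", OF G_Omega _ _ t]) auto
qed

section \<open>Upper bound in the lacunary case: counting chains of fractions\<close>

text \<open>Every \<open>\<gamma>\<close> considered follows a chain of fractions \<open>j\<^sub>k / q\<^sub>k\<close>, and each fraction has at most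
  \<open>9 * sqrt (q\<^sub>k\<^sub>+\<^sub>1 / q\<^sub>k)\<close> successors, so that only about \<open>sqrt q\<^sub>k\<close> of them occur at level \<open>k\<close>.\<close>
lemma approximable_chain_cover:
  assumes \<tau>: "0 < \<tau>"
  obtains K C where "0 < C" "\<And>k. K \<le> k \<Longrightarrow> \<exists>S::int set. finite S \<and>
     real (card S) \<le> C * of_int (q k) powr (1/2 + \<tau>) \<and>
     (\<forall>\<gamma>\<in>approximable \<alpha> N. \<exists>j\<in>S. \<bar>\<gamma> - of_int j / of_int (q k)\<bar> \<le> 2 / sqrt (of_int (q k) * of_int (q (Suc k))))"
proof -
  define Q where "Q = (\<lambda>k. real_of_int (q k))"
  define X where "X = (\<lambda>k. sqrt (Q k * Q (Suc k)))"
  have Q1: "1 \<le> Q k" for k using q_pos_real by (simp add: Q_def)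
  have Qm: "Q k \<le> Q (Suc k)" for k using q_mono by (simp add: Q_def)
  have QX: "Q k \<le> X k" for k
    unfolding X_def by (rule real_le_rsqrt) (use Q1[of k] Qm[of k] in \<open>simp add: power2_eq_square mult_mono\<close>)
  have Xpos: "0 < X k" for k using QX[of k] Q1[of k] by linarith
  have Xm: "X k \<le> X (Suc k)" for k
    unfolding X_def using Q1[of k] Q1[of "Suc k"] Qm[of k] Qm[of "Suc k"]
    by (intro real_sqrt_le_mono mult_mono) auto
  \<comment> \<open>The factor 9 lost at each level of the chain is absorbed by the spare exponent
    \<tau>.\<close>
  have "eventually (\<lambda>k. 9 \<le> rho k powr \<tau>) sequentially" by (rule rho_powr_large[OF \<tau>])
  moreover have "eventually (\<lambda>k. max 2 (real N) \<le> Q k) sequentially"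
    using q_top unfolding Q_def filterlim_at_top by blast
  ultimately have "eventually (\<lambda>k. 9 \<le> rho k powr \<tau> \<and> max 2 (real N) \<le> Q k) sequentially"
    by (rule eventually_conj)
  then obtain K where K: "\<And>k. K \<le> k \<Longrightarrow> 9 \<le> rho k powr \<tau> \<and> max 2 (real N) \<le> Q k"
    by (auto simp: eventually_sequentially)
  have near: "\<exists>j::int. \<bar>\<gamma> - j / Q k\<bar> \<le> 2 / X k" if k: "K \<le> k" and \<gamma>: "\<gamma> \<in> approximable \<alpha> N" for k \<gamma>
  proof -
    have "\<bar>(Q k * \<alpha> - p k) / Q k\<bar> \<le> 1 / Q (Suc k) / Q k"
      using divide_right_mono[OF theta_le[of k], of "Q k"] Q1[of k] by (simp add: Q_def)
    then have "\<bar>\<alpha> - p k / of_int (q k)\<bar> \<le> 1 / (X k)\<^sup>2"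
      using Q1[of k] Q1[of "Suc k"] by (simp add: X_def Q_def diff_divide_distrib mult.commute)
    moreover have "real N \<le> X k" using K[OF k] QX[of k] by simp
    moreover have "0 < q k" using q_pos[of k] by simp
    ultimately show ?thesis
      using approximable_near_rational[OF \<gamma> _ Xpos[of k], of "q k" "p k"] unfolding Q_def by blast
  qed
  \<comment> \<open>The starting level admits every fraction of denominator \<open>q K\<close> near
    the unit interval; \<open>C\<close> pays for these once.\<close>
  define C where "C = 7 * Q K"
  have "\<exists>S::int set. finite S \<and> real (card S) \<le> C * Q k powr (1/2 + \<tau>) \<and>
     (\<forall>\<gamma>\<in>approximable \<alpha> N. \<exists>j\<in>S. \<bar>\<gamma> - j / Q k\<bar> \<le> 2 / X k)" if "K \<le> k" for k
    using that
  proof (induction k rule: dec_induct)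
    case base
    let ?S = "{- 3 * q K..3 * q K}"
    have "real (card ?S) \<le> C"
      using q_pos[of K] by (simp add: C_def Q_def)
    also have "\<dots> \<le> C * Q K powr (1/2 + \<tau>)"
      using Q1[of K] \<tau> ge_one_powr_ge_zero[of "Q K" "1/2 + \<tau>"] by (simp add: C_def)
    finally have "real (card ?S) \<le> C * Q K powr (1/2 + \<tau>)" .
    moreover have "\<exists>j\<in>?S. \<bar>\<gamma> - j / Q K\<bar> \<le> 2 / X K" if \<gamma>: "\<gamma> \<in> approximable \<alpha> N" for \<gamma>
    proof -
      obtain j :: int where j: "\<bar>\<gamma> - j / Q K\<bar> \<le> 2 / X K" using near[OF order_refl \<gamma>] by blast
      have "2 / X K \<le> 1" using K[of K] QX[of K] by simp
      then have "\<bar>j / Q K\<bar> \<le> 3"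
        using j \<gamma> unfolding approximable_def mem_Collect_eq atLeastLessThan_iff by linarith
      then have "\<bar>real_of_int j\<bar> \<le> real_of_int (3 * q K)" using Q1[of K] by (simp add: field_simps Q_def)
      then have "\<bar>j\<bar> \<le> 3 * q K" by linarith
      then have "j \<in> ?S" by auto
      then show ?thesis using j by blast
    qed
    ultimately show ?case by blast
  next
    case (step k)
    then obtain S :: "int set" where S: "finite S" "real (card S) \<le> C * Q k powr (1/2 + \<tau>)"
      "\<And>\<gamma>. \<gamma> \<in> approximable \<alpha> N \<Longrightarrow> \<exists>j\<in>S. \<bar>\<gamma> - j / Q k\<bar> \<le> 2 / X k" by auto
    \<comment> \<open>Consecutive fractions of a chain differ by at most \<open>4 / X k\<close>;
      multiplying by \<open>Q (Suc k)\<close> gives the window for the next numerator. Its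
      half-width equals \<open>4 * sqrt (rho k)\<close>.\<close>
    define y where "y = 4 * Q (Suc k) / X k"
    define f where "f = (\<lambda>j::int. {i::int. \<bar>of_int i - j * Q (Suc k) / Q k\<bar> \<le> y})"
    have y: "0 \<le> y" using Q1[of "Suc k"] Xpos[of k] by (simp add: y_def)
    have rho: "1 \<le> rho k" using Qm[of k] Q1[of k] by (simp add: rho_def Q_def)
    have "y = 4 * sqrt (rho k)"
      using Q1[of k] Q1[of "Suc k"]
      by (simp add: y_def X_def rho_def Q_def real_sqrt_mult real_sqrt_divide field_simps flip: power2_eq_square)
    then have "2 * y + 1 \<le> 9 * rho k powr (1/2)"
      using rho real_sqrt_ge_1_iff[of "rho k"] by (simp add: powr_half_sqrt)
    also have "\<dots> \<le> rho k powr \<tau> * rho k powr (1/2)"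
      using K[of k] step by (intro mult_right_mono) auto
    also have "\<dots> = rho k powr (1/2 + \<tau>)" by (simp add: powr_add)
    finally have y_le: "2 * y + 1 \<le> rho k powr (1/2 + \<tau>)" .
    have card_f: "real (card (f j)) \<le> rho k powr (1/2 + \<tau>)" for j
      using card_ints_near(2)[OF y, of "j * Q (Suc k) / Q k"] y_le by (simp add: f_def)
    have "card (\<Union>j\<in>S. f j) \<le> (\<Sum>j\<in>S. card (f j))" by (rule card_UN_le[OF S(1)])
    then have "real (card (\<Union>j\<in>S. f j)) \<le> (\<Sum>j\<in>S. real (card (f j)))"
      by (metis of_nat_le_iff of_nat_sum)
    also have "\<dots> \<le> (\<Sum>j\<in>S. rho k powr (1/2 + \<tau>))" using card_f by (intro sum_mono) auto
    also have "\<dots> \<le> (C * Q k powr (1/2 + \<tau>)) * rho k powr (1/2 + \<tau>)"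
      using S(2) by (simp add: mult_right_mono)
    also have "\<dots> = C * Q (Suc k) powr (1/2 + \<tau>)"
      using Q1[of k] Q1[of "Suc k"] by (simp add: rho_def powr_divide Q_def)
    finally have "real (card (\<Union>j\<in>S. f j)) \<le> C * Q (Suc k) powr (1/2 + \<tau>)" .
    moreover have "finite (\<Union>j\<in>S. f j)"
      using S(1) card_ints_near(1)[OF y] by (auto simp: f_def)
    moreover have "\<exists>i\<in>(\<Union>j\<in>S. f j). \<bar>\<gamma> - i / Q (Suc k)\<bar> \<le> 2 / X (Suc k)"
      if \<gamma>: "\<gamma> \<in> approximable \<alpha> N" for \<gamma>
    proof -
      obtain j where j: "j \<in> S" "\<bar>\<gamma> - j / Q k\<bar> \<le> 2 / X k" using S(3)[OF \<gamma>] by blast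
      obtain i :: int where i: "\<bar>\<gamma> - i / Q (Suc k)\<bar> \<le> 2 / X (Suc k)"
        using near[OF _ \<gamma>, of "Suc k"] step by auto
      have "2 / X (Suc k) \<le> 2 / X k" using Xm[of k] Xpos[of k] Xpos[of "Suc k"]
        by (intro divide_left_mono) auto
      then have "\<bar>i / Q (Suc k) - j / Q k\<bar> \<le> 4 / X k" using i j by linarith
      then have "Q (Suc k) * \<bar>i / Q (Suc k) - j / Q k\<bar> \<le> Q (Suc k) * (4 / X k)"
        using Q1[of "Suc k"] by (intro mult_left_mono) auto
      moreover have "Q (Suc k) * \<bar>i / Q (Suc k) - j / Q k\<bar> = \<bar>Q (Suc k) * (i / Q (Suc k) - j / Q k)\<bar>"
        using Q1[of "Suc k"] by (simp add: abs_mult)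
      moreover have "Q (Suc k) * (i / Q (Suc k) - j / Q k) = i - j * Q (Suc k) / Q k"
        using Q1[of "Suc k"] by (simp add: right_diff_distrib)
      ultimately have "\<bar>i - j * Q (Suc k) / Q k\<bar> \<le> y" by (simp add: y_def mult.commute)
      then have "i \<in> (\<Union>j\<in>S. f j)" using j(1) by (auto simp: f_def)
      then show ?thesis using i by blast
    qed
    ultimately show ?case by blast
  qed
  moreover have "0 < C" using Q1[of K] by (simp add: C_def)
  ultimately show ?thesis using that[of C K] unfolding Q_def X_def by blast
qed

lemma approximable_null_lacunary:
  assumes w: "0 < w" and s: "1 / (w + 1) < s"
    and freq: "\<And>n. \<exists>k\<ge>n. of_int (q k) powr w \<le> 2 * real_of_int (q (Suc k))"
  shows "hausdorff_measure s (approximable \<alpha> N) = 0"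
proof (rule hausdorff_measure_zero_finite_cover)
  fix e :: real assume e: "0 < e"
  \<comment> \<open>The total cost has exponent \<open>1/2 + \<tau> - s * (w + 1) / 2\<close> in
    \<open>q k\<close>, and this choice makes it \<open>- \<tau>\<close>.\<close>
  define \<tau> where "\<tau> = (s * (w + 1) - 1) / 4"
  have \<tau>: "0 < \<tau>" using s w by (simp add: \<tau>_def field_simps)
  have s0: "0 < s" using s w by (meson add_pos_pos divide_pos_pos less_trans zero_less_one)
  obtain K C where C: "0 < C" and K: "\<And>k. K \<le> k \<Longrightarrow> \<exists>S::int set. finite S \<and>
     real (card S) \<le> C * of_int (q k) powr (1/2 + \<tau>) \<and>
     (\<forall>\<gamma>\<in>approximable \<alpha> N. \<exists>j\<in>S. \<bar>\<gamma> - of_int j / of_int (q k)\<bar> \<le> 2 / sqrt (of_int (q k) * of_int (q (Suc k))))"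
    using approximable_chain_cover[OF \<tau>, of N] by metis
  have "((\<lambda>x::real. 4 * x powr (- ((w + 1) / 2))) \<longlongrightarrow> 0) at_top" using w by real_asymp
  then have "eventually (\<lambda>x::real. 4 * x powr (- ((w + 1) / 2)) < e) at_top"
    by (rule order_tendstoD) (use e in auto)
  moreover have "((\<lambda>x::real. C * 8 powr s * x powr (- \<tau>)) \<longlongrightarrow> 0) at_top" using \<tau> by real_asymp
  then have "eventually (\<lambda>x::real. C * 8 powr s * x powr (- \<tau>) < e) at_top"
    by (rule order_tendstoD) (use e in auto)
  ultimately have "eventually (\<lambda>x. 4 * x powr (- ((w + 1) / 2)) < e \<and> C * 8 powr s * x powr (- \<tau>) < e) at_top"
    by (rule eventually_conj)
  then have "eventually (\<lambda>k. 4 * of_int (q k) powr (- ((w + 1) / 2)) < e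
      \<and> C * 8 powr s * of_int (q k) powr (- \<tau>) < e) sequentially"
    using q_top by (rule eventually_compose_filterlim)
  then obtain M where M: "\<And>k. M \<le> k \<Longrightarrow> 4 * of_int (q k) powr (- ((w + 1) / 2)) < e
      \<and> C * 8 powr s * of_int (q k) powr (- \<tau>) < e"
    by (auto simp: eventually_sequentially)
  obtain k where k: "max K M \<le> k" "of_int (q k) powr w \<le> 2 * real_of_int (q (Suc k))"
    using freq by blast
  define x where "x = real_of_int (q k)"
  define r where "r = 2 / sqrt (x * of_int (q (Suc k)))"
  have x: "1 \<le> x" using q_pos_real by (simp add: x_def)
  have x1: "4 * x powr (- ((w + 1) / 2)) < e" "C * 8 powr s * x powr (- \<tau>) < e"
    using M[of k] k(1) by (auto simp: x_def)
  have r0: "0 < r" using x q_pos_real[of "Suc k"] by (simp add: r_def)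
  have r_le: "r \<le> 4 * x powr (- ((w + 1) / 2))"
  proof -
    \<comment> \<open>The weaker constant 1/4 in place of 1/2 has a rational square root.\<close>
    have "x powr (w + 1) / 4 \<le> x * of_int (q (Suc k))"
    proof -
      have "x powr (w + 1) \<le> x * (2 * real_of_int (q (Suc k)))"
        using k(2) x by (simp add: powr_add x_def)
      moreover have "0 \<le> x * real_of_int (q (Suc k))" using x q_pos_real[of "Suc k"] by simp
      ultimately show ?thesis by simp
    qed
    then have "sqrt (x powr (w + 1) / 4) \<le> sqrt (x * of_int (q (Suc k)))" by (rule real_sqrt_le_mono)
    moreover have "sqrt (x powr (w + 1) / 4) = x powr ((w + 1) / 2) / 2"
      using x by (simp add: real_sqrt_divide powr_half_sqrt[symmetric] powr_powr)
    ultimately have "r \<le> 2 / (x powr ((w + 1) / 2) / 2)"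
      unfolding r_def using x q_pos_real[of "Suc k"] by (intro divide_left_mono mult_pos_pos) auto
    then show ?thesis by (simp add: powr_minus_divide)
  qed
  obtain S :: "int set" where S: "finite S" "real (card S) \<le> C * x powr (1/2 + \<tau>)"
    "\<forall>\<gamma>\<in>approximable \<alpha> N. \<exists>j\<in>S. \<bar>\<gamma> - of_int j / x\<bar> \<le> r"
    using K[of k] k(1) unfolding x_def r_def by auto
  have "real (card ((\<lambda>j. of_int j / x) ` S)) \<le> C * x powr (1/2 + \<tau>)"
    using S(2) card_image_le[OF S(1), of "\<lambda>j. of_int j / x"] by linarith
  moreover have "(2 * r) powr s \<le> (8 * x powr (- ((w + 1) / 2))) powr s"
    using r_le r0 s0 by (intro powr_mono2) auto
  ultimately have "real (card ((\<lambda>j. of_int j / x) ` S)) * (2 * r) powr s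
      \<le> (C * x powr (1/2 + \<tau>)) * (8 * x powr (- ((w + 1) / 2))) powr s"
    using C by (intro mult_mono) auto
  also have "\<dots> = C * 8 powr s * (x powr (1/2 + \<tau>) * x powr (- ((w + 1) / 2) * s))"
    by (simp add: powr_mult powr_powr)
  also have "x powr (1/2 + \<tau>) * x powr (- ((w + 1) / 2) * s) = x powr (1/2 + \<tau> + - ((w + 1) / 2) * s)"
    by (simp only: powr_add)
  also have "1/2 + \<tau> + - ((w + 1) / 2) * s = - \<tau>"
    by (simp add: \<tau>_def field_simps)
  finally have "real (card ((\<lambda>j. of_int j / x) ` S)) * (2 * r) powr s < e" using x1(2) by simp
  moreover have "approximable \<alpha> N \<subseteq> (\<Union>z\<in>(\<lambda>j. of_int j / x) ` S. cball z r)"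
    using S(3) by (force simp: dist_real_def abs_minus_commute)
  ultimately show "\<exists>S r. finite S \<and> 0 < r \<and> r < e \<and> approximable \<alpha> N \<subseteq> (\<Union>x\<in>S. cball x r) \<and>
      real (card S) * (2 * r) powr s < e"
    using S(1) r0 r_le x1(1) by (intro exI[of _ "(\<lambda>j. of_int j / x) ` S"] exI[of _ r]) auto
qed

section \<open>Growth of denominators and the irrationality exponent\<close>

text \<open>If \<open>x\<close> did better, the integer \<open>x * p (Suc k) - m * q (Suc k)\<close>
  would have absolute value below 1 and so vanish; coprimality would then make
  \<open>q (Suc k)\<close> divide the smaller positive number \<open>x\<close>. The bound on
  \<open>rho\<close> keeps the error of the convergent, multiplied by \<open>x\<close>, at most
  1/2.\<close>

lemma dnint_ge_convergent:
  assumes x: "1 \<le> x" "int x < q (Suc k)" and rho: "2 \<le> rho (Suc k)"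
  shows "1 / (2 * of_int (q (Suc k))) \<le> dnint (real x * \<alpha>)"
proof (rule ccontr)
  assume neg: "\<not> ?thesis"
  define m where "m = round (real x * \<alpha>)"
  define Q where "Q = real_of_int (q (Suc k))"
  define Q' where "Q' = real_of_int (q (Suc (Suc k)))"
  define P where "P = real_of_int (p (Suc k))"
  have Q: "1 \<le> Q" "1 \<le> Q'" using q_pos_real by (auto simp: Q_def Q'_def)
  have QQ: "2 * Q \<le> Q'" using rho Q by (simp add: rho_def Q_def Q'_def field_simps)
  have "\<bar>real x * \<alpha> - m\<bar> < 1 / (2 * Q)" using neg by (simp add: dnint_def m_def Q_def not_le)
  then have "Q * \<bar>real x * \<alpha> - m\<bar> < Q * (1 / (2 * Q))" using Q by (intro mult_strict_left_mono) auto
  then have 1: "\<bar>Q * (real x * \<alpha> - m)\<bar> < 1/2" using Q by (simp add: abs_mult)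
  have xQ: "real x < Q" using x(2) unfolding Q_def by linarith
  have "real x * \<bar>Q * \<alpha> - P\<bar> \<le> Q * (1 / Q')"
    using theta_le[of "Suc k"] xQ Q by (intro mult_mono) (auto simp: Q_def Q'_def P_def)
  also have "\<dots> \<le> 1/2" using QQ Q by (simp add: field_simps)
  finally have 2: "\<bar>real x * (Q * \<alpha> - P)\<bar> \<le> 1/2" by (simp add: abs_mult)
  have "real_of_int (int x * p (Suc k) - m * q (Suc k)) = Q * (real x * \<alpha> - m) - real x * (Q * \<alpha> - P)"
    by (simp add: Q_def P_def algebra_simps)
  then have "\<bar>real_of_int (int x * p (Suc k) - m * q (Suc k))\<bar> < 1" using 1 2 by linarith
  then have "int x * p (Suc k) = m * q (Suc k)" by linarith
  then have "q (Suc k) dvd int x * p (Suc k)" by simp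
  then have "q (Suc k) dvd int x"
    using coprime_p_q[of "Suc k"] by (simp add: coprime_dvd_mult_left_iff coprime_commute)
  then have "q (Suc k) \<le> int x" using x(1) by (intro zdvd_imp_le) auto
  then show False using x(2) by simp
qed

text \<open>A good denominator \<open>x\<close> lies between some \<open>q k\<close> and
  \<open>q (Suc k)\<close>. Its error is at least \<open>1 / (2 * q (Suc k))\<close> but below
  \<open>x powr (-w)\<close>, which is at most \<open>q k powr (-w)\<close>. Choosing
  \<open>x\<close> large forces \<open>k\<close> to be large.\<close>

lemma convergent_growth_frequently:
  assumes w: "0 < w" and inf: "infinite {x::nat. x > 0 \<and> dnint (real x * \<alpha>) < real x powr (-w)}"
  shows "\<exists>k\<ge>n. of_int (q k) powr w \<le> 2 * real_of_int (q (Suc k))"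
proof -
  have "eventually (\<lambda>k. 2 \<le> rho k) sequentially" using rho_top by (simp add: filterlim_at_top)
  then obtain M where M: "\<And>k. M \<le> k \<Longrightarrow> 2 \<le> rho k" by (auto simp: eventually_sequentially)
  define n' where "n' = max n M"
  obtain x where x: "nat (q n') \<le> x" "0 < x" "dnint (real x * \<alpha>) < real x powr (-w)"
    using inf unfolding infinite_nat_iff_unbounded_le by blast
  have "eventually (\<lambda>k. real x < real_of_int (q k)) sequentially"
    using q_top unfolding filterlim_at_top_dense by blast
  then obtain j where "real x < real_of_int (q j)" by (auto simp: eventually_sequentially)
  then have "int x < q j" by linarith
  then obtain m where m: "int x < q m" "\<And>i. i < m \<Longrightarrow> \<not> int x < q i"
    using exists_least_iff[of "\<lambda>i. int x < q i"] by blast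
  have mono: "q i \<le> q j" if "i \<le> j" for i j using lift_Suc_mono_le[of q, OF q_mono that] .
  have "n' < m"
  proof (rule ccontr)
    assume "\<not> n' < m"
    then have "q m \<le> q n'" by (intro mono) simp
    then show False using m(1) x(1) by linarith
  qed
  then obtain k where k: "m = Suc k" "n' \<le> k" by (cases m) auto
  have xk: "q k \<le> int x" using m(2)[of k] k(1) by simp
  have "1 / (2 * of_int (q (Suc k))) \<le> dnint (real x * \<alpha>)"
    using x(2) m(1) k M[of "Suc k"] by (intro dnint_ge_convergent) (auto simp: n'_def)
  then have "1 / (2 * real_of_int (q (Suc k))) < 1 / real x powr w"
    using x(3) by (simp add: powr_minus_divide)
  then have "real x powr w < 2 * real_of_int (q (Suc k))"
    using x(2) q_pos_real[of "Suc k"] by (simp add: field_simps)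
  moreover have "of_int (q k) powr w \<le> real x powr w"
    using xk q_pos_real[of k] w by (intro powr_mono2) linarith+
  ultimately show ?thesis using k(2) by (intro exI[of _ k]) (auto simp: n'_def)
qed

text \<open>Only finitely many denominators achieve an exponent above
  \<open>irr_exp \<alpha>\<close>, so eventually \<open>q k\<close> itself fails to, while its error
  is at most \<open>1 / q (Suc k)\<close>.\<close>

lemma convergent_growth_le:
  assumes w: "irr_exp \<alpha> < ereal w" "0 < w"
  shows "eventually (\<lambda>k. real_of_int (q (Suc k)) \<le> of_int (q k) powr w) sequentially"
proof -
  have fin: "finite {x::nat. x > 0 \<and> dnint (real x * \<alpha>) < real x powr (-w)}"
  proof (rule ccontr)
    assume "\<not> ?thesis"
    then have "ereal w \<le> irr_exp \<alpha>" unfolding irr_exp_def using w(2) by (intro Sup_upper) auto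
    then show False using w(1) by simp
  qed
  then obtain b where b: "\<And>x::nat. x > 0 \<Longrightarrow> dnint (real x * \<alpha>) < real x powr (-w) \<Longrightarrow> x \<le> b"
    unfolding finite_nat_set_iff_bounded_le by blast
  have "eventually (\<lambda>k. real b < real_of_int (q k)) sequentially"
    using q_top unfolding filterlim_at_top_dense by blast
  then show ?thesis
  proof eventually_elim
    case (elim k)
    have x: "real (nat (q k)) = real_of_int (q k)" using q_pos[of k] by simp
    have "\<not> nat (q k) \<le> b" using elim q_pos[of k] by linarith
    then have "real_of_int (q k) powr (-w) \<le> dnint (of_int (q k) * \<alpha>)"
      using b[of "nat (q k)"] q_pos[of k] unfolding x by force
    also have "\<dots> \<le> 1 / of_int (q (Suc k))"
      using dnint_le[of "of_int (q k) * \<alpha>" "p k"] theta_le[of k] by linarith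
    finally show ?case
      using q_pos_real[of k] q_pos_real[of "Suc k"] by (simp add: powr_minus field_simps)
  qed
qed

lemma Omega11_null_of_irr_exp:
  assumes "0 < w" "1 / (w + 1) < s" "infinite {x::nat. x > 0 \<and> dnint (real x * \<alpha>) < real x powr (-w)}"
  shows "hausdorff_measure s (Omega11 \<alpha>) = 0"
  using assms by (intro Omega11_null approximable_null_lacunary convergent_growth_frequently)

lemma Omega11_measure_nonzero_of_irr_exp:
  assumes w: "irr_exp \<alpha> = ereal w" "0 < w" and s: "0 \<le> s" "s < 1 / (w + 1)"
  shows "hausdorff_measure s (Omega11 \<alpha>) \<noteq> 0"
proof -
  define b where "b = 1 / (w + 1)"
  define s' where "s' = (s + b) / 2"
  have b: "0 < b" "s < b" using w(2) s(2) by (simp_all add: b_def)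
  have s': "0 < s'" "s \<le> s'" "s' < b" using s(1) b by (simp_all add: s'_def)
  define w' where "w' = (w + (1 / s' - 1)) / 2"
  have "w < 1 / s' - 1" using s' w(2) by (simp add: b_def field_simps)
  then have w': "w < w'" "w' < 1 / s' - 1" by (simp_all add: w'_def)
  have sw: "s' * w' < 1 - s'" using w'(2) s'(1) by (simp add: field_simps)
  have s1: "s' < 1" using sw s'(1) w' w(2) by (smt (verit) mult_pos_pos)
  \<comment> \<open>The solution \<open>v\<close> of \<open>s' * (w' * (1 - v) + v) = v\<close>. It
    is below 1/2 exactly because \<open>s' * w' < 1 - s'\<close>, which leaves room for
    \<open>v\<close> strictly between \<open>v0\<close> and 1/2.\<close>
  define v0 where "v0 = s' * w' / (1 - s' + s' * w')"
  define v where "v = (v0 + 1/2) / 2"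
  have den: "0 < 1 - s' + s' * w'" using s1 s'(1) w' w(2) by (intro add_pos_pos mult_pos_pos) auto
  have v0: "0 < v0" "v0 < 1/2" using sw den s'(1) w' w(2) unfolding v0_def
    by (auto simp: field_simps)
  then have v: "0 < v" "v < 1/2" "v0 < v" by (simp_all add: v_def)
  have "s' * w' < v * (1 - s' + s' * w')"
    using v(3) den unfolding v0_def by (simp add: pos_divide_less_eq)
  then have vs: "s' * (w' * (1 - v) + v) < v" by (simp add: algebra_simps)
  show ?thesis
    by (rule Omega11_measure_nonzero[OF s'(1) _ v(1,2) _ vs _ s(1) s'(2)])
      (use s1 w' w convergent_growth_le[of w'] in auto)
qed

end

section \<open>Irrationality exponent and conclusion\<close>

text \<open>By Dirichlet's theorem: finitely many good denominators would leave a positive minimal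
  error, as \<alpha> is irrational, but a large bound \<open>N\<close> yields a good denominator
  with smaller error.\<close>

lemma irr_exp_ge_1:
  assumes "\<alpha> \<notin> \<rat>"
  shows "1 \<le> irr_exp \<alpha>"
proof -
  define A where "A = {x::nat. x > 0 \<and> dnint (real x * \<alpha>) < real x powr (-1)}"
  have pos: "0 < dnint (real x * \<alpha>)" if "0 < x" for x
  proof (rule ccontr)
    assume "\<not> ?thesis"
    then have "real x * \<alpha> = of_int (round (real x * \<alpha>))" by (simp add: dnint_def)
    then have "\<alpha> = of_int (round (real x * \<alpha>)) / real x" using that by (simp add: field_simps)
    then show False using assms by (metis Rats_divide Rats_of_int Rats_of_nat)
  qed
  have "infinite A"
  proof
    assume fin: "finite A"
    \<comment> \<open>Inserting 1 keeps the minimum meaningful when \<open>A\<close> is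
      empty.\<close>
    define d where "d = Min (insert 1 ((\<lambda>x. dnint (real x * \<alpha>)) ` A))"
    have "0 < d" unfolding d_def using fin pos by (subst Min_gr_iff) (auto simp: A_def)
    then obtain N where N: "0 < N" "1 / real N < d"
      by (metis inverse_eq_divide reals_Archimedean zero_less_Suc)
    obtain h k where hk: "0 < k" "k \<le> int N" "\<bar>of_int k * \<alpha> - of_int h\<bar> < 1 / N"
      using Dirichlet_approx[OF N(1), of \<alpha>] by blast
    define x where "x = nat k"
    have kx: "k = int x" using hk(1) by (simp add: x_def)
    have x: "0 < x" "x \<le> N" using hk(1,2) kx by auto
    have dn: "dnint (real x * \<alpha>) < 1 / N"
      using dnint_le[of "real x * \<alpha>" h] hk(3) by (simp add: kx)
    also have "\<dots> \<le> 1 / x" using x by (intro divide_left_mono) auto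
    finally have "x \<in> A" using x by (simp add: A_def powr_minus_divide)
    then have "d \<le> dnint (real x * \<alpha>)" unfolding d_def using fin by (intro Min_le) auto
    then show False using dn N(2) by linarith
  qed
  then have "ereal 1 \<le> irr_exp \<alpha>"
    unfolding irr_exp_def A_def by (intro Sup_upper) (auto intro!: exI[of _ 1])
  then show ?thesis by (simp only: one_ereal_def)
qed

lemma irr_exp_infinite:
  assumes "ereal w < irr_exp \<alpha>"
  shows "infinite {x::nat. x > 0 \<and> dnint (real x * \<alpha>) < real x powr (-w)}"
proof -
  obtain s where s: "w < s" "infinite {x::nat. x > 0 \<and> dnint (real x * \<alpha>) < real x powr (-s)}"
    using assms unfolding irr_exp_def less_Sup_iff by auto
  have "dnint (real x * \<alpha>) < real x powr (-w)" if "x > 0" "dnint (real x * \<alpha>) < real x powr (-s)" for x :: nat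
  proof -
    have "real x powr (-s) \<le> real x powr (-w)"
      using s(1) that(1) by (intro powr_mono) auto
    then show ?thesis using that(2) by linarith
  qed
  then have "{x::nat. x > 0 \<and> dnint (real x * \<alpha>) < real x powr (-s)}
      \<subseteq> {x. x > 0 \<and> dnint (real x * \<alpha>) < real x powr (-w)}"
    by blast
  then show ?thesis using s(2) by (rule infinite_super)
qed

text \<open>Shared by both upper bounds, with \<open>c = 2\<close> in general and
  \<open>c = 1\<close> in the lacunary case. For infinite exponent the right-hand side is 0.\<close>

lemma hausdorff_dim_le_irr_exp:
  assumes \<alpha>: "\<alpha> \<notin> \<rat>" and c: "0 < c"
    and null: "\<And>w s. 0 < w \<Longrightarrow> c / (w + 1) < s \<Longrightarrow>
      infinite {x::nat. x > 0 \<and> dnint (real x * \<alpha>) < real x powr (-w)} \<Longrightarrow> hausdorff_measure s E = 0"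
  shows "ereal (hausdorff_dim E) \<le> ereal c / (irr_exp \<alpha> + 1)"
proof -
  have ge1: "1 \<le> irr_exp \<alpha>" by (rule irr_exp_ge_1[OF \<alpha>])
  obtain x where x: "ereal c / (irr_exp \<alpha> + 1) = ereal x" "0 \<le> x"
    "\<And>r. irr_exp \<alpha> = ereal r \<Longrightarrow> x = c / (r + 1)"
  proof (cases "irr_exp \<alpha>")
    case (real r)
    then have r: "1 \<le> r" using ge1 by simp
    have "irr_exp \<alpha> + 1 = ereal (r + 1)" using real by simp
    then have eq: "ereal c / (irr_exp \<alpha> + 1) = ereal (c / (r + 1))" using r by simp
    show ?thesis
    proof (rule that[OF eq])
      show "0 \<le> c / (r + 1)" using r c by simp
      show "c / (r + 1) = c / (r' + 1)" if "irr_exp \<alpha> = ereal r'" for r'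
        using real that by simp
    qed
  next
    case PInf
    then show ?thesis using that[of 0] by simp
  next
    case MInf
    then show ?thesis using ge1 by simp
  qed
  have "hausdorff_dim E \<le> s" if s: "x < s" for s
  proof (rule hausdorff_dim_le)
    have s0: "0 < s" using s x(2) by simp
    then show "0 \<le> s" by simp
    \<comment> \<open>Any \<open>w\<close> above \<open>m\<close> is positive and satisfies
      \<open>c / (w + 1) < s\<close>.\<close>
    define m where "m = max 0 (c / s - 1)"
    have "ereal m < irr_exp \<alpha>"
    proof (cases "irr_exp \<alpha>")
      case (real r)
      then have "1 \<le> r" "x = c / (r + 1)" using ge1 x(3) by simp_all
      then have "c < s * (r + 1)" using s by (simp add: pos_divide_less_eq)
      then have "c / s < r + 1" using s0 by (simp add: pos_divide_less_eq mult.commute)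
      then have "m < r" using \<open>1 \<le> r\<close> by (simp add: m_def)
      then show ?thesis using real by simp
    next
      case PInf
      then show ?thesis by simp
    next
      case MInf
      then show ?thesis using ge1 by simp
    qed
    then obtain w where "ereal m < ereal w" and w: "ereal w < irr_exp \<alpha>"
      using ereal_dense2 by blast
    then have mw: "m < w" by simp
    then have "0 < w" "c / (w + 1) < s" using s0 mw by (auto simp: m_def field_simps)
    then show "hausdorff_measure s E = 0" using irr_exp_infinite[OF w] by (rule null)
  qed
  then have "hausdorff_dim E \<le> x" by (rule dense_ge)
  then show ?thesis using x(1) by simp
qed

lemma lacunary_convergents_cf:
  assumes \<alpha>: "\<alpha> \<in> {0..<1}" "\<alpha> \<notin> \<rat>" and lam: "1 < lam"
    and lim: "ereal lam < liminf (\<lambda>k. ereal (ln (real_of_int (cf_q \<alpha> (Suc k))) / ln (real_of_int (cf_q \<alpha> k))))"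
  shows "lacunary_convergents \<alpha> lam (cf_p \<alpha>) (cf_q \<alpha>)"
proof
  show "1 \<le> cf_q \<alpha> k" "cf_q \<alpha> k \<le> cf_q \<alpha> (Suc k)" for k using cf_q_ge[OF \<alpha>(2)] by auto
  have "real k \<le> real_of_int (cf_q \<alpha> (Suc k))" for k
    using cf_q_ge[OF \<alpha>(2), of k] by linarith
  then have "filterlim (\<lambda>k. real_of_int (cf_q \<alpha> (Suc k))) at_top sequentially"
    by (intro filterlim_at_top_mono[OF filterlim_real_sequentially] always_eventually allI)
  then show top: "filterlim (\<lambda>k. real_of_int (cf_q \<alpha> k)) at_top sequentially"
    by (simp only: filterlim_sequentially_Suc[where f = "\<lambda>k. real_of_int (cf_q \<alpha> k)"])
  have "eventually (\<lambda>k. ereal lam < ereal (ln (real_of_int (cf_q \<alpha> (Suc k))) / ln (real_of_int (cf_q \<alpha> k)))) sequentially"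
    using lim by (rule less_LiminfD)
  \<comment> \<open>The logarithm in the denominator must be positive before the quotient can be
    cleared; it vanishes while the denominator of the convergent is 1.\<close>
  moreover have "eventually (\<lambda>k. 1 < real_of_int (cf_q \<alpha> k)) sequentially"
    using top unfolding filterlim_at_top_dense by blast
  ultimately show "eventually (\<lambda>k. real_of_int (cf_q \<alpha> k) powr lam \<le> real_of_int (cf_q \<alpha> (Suc k))) sequentially"
  proof eventually_elim
    case (elim k)
    have "0 < real_of_int (cf_q \<alpha> (Suc k))" using cf_q_ge[OF \<alpha>(2), of k] elim by linarith
    moreover have "lam * ln (real_of_int (cf_q \<alpha> k)) \<le> ln (real_of_int (cf_q \<alpha> (Suc k)))"
      using elim by (simp add: field_simps)
    ultimately show ?case using elim by (simp add: powr_def ln_ge_iff)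
  qed
qed (use \<alpha> lam cf_theta_bounds[OF \<alpha>(2), unfolded cf_theta_def] coprime_cf_p_cf_q in auto)

theorem theorem1p5:
  shows "(\<forall>\<alpha>::real. \<alpha> \<in> {0..<1} \<and> \<alpha> \<notin> \<rat> \<longrightarrow>
            ereal (hausdorff_dim (Omega11 \<alpha>)) \<le> 2 / (irr_exp \<alpha> + 1))
       \<and> (\<forall>\<alpha>::real. \<alpha> \<in> {0..<1} \<and> \<alpha> \<notin> \<rat> \<and>
            liminf (\<lambda>k. ereal (ln (real_of_int (cf_q \<alpha> (Suc k))) / ln (real_of_int (cf_q \<alpha> k)))) > 1
            \<longrightarrow> ereal (hausdorff_dim (Omega11 \<alpha>)) = 1 / (irr_exp \<alpha> + 1))"
proof (intro conjI allI impI; elim conjE)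
  fix \<alpha> :: real assume \<alpha>: "\<alpha> \<in> {0..<1}" "\<alpha> \<notin> \<rat>"
  have "ereal (hausdorff_dim (Omega11 \<alpha>)) \<le> ereal 2 / (irr_exp \<alpha> + 1)"
    by (intro hausdorff_dim_le_irr_exp[OF \<alpha>(2)] Omega11_null approximable_null) auto
  then show "ereal (hausdorff_dim (Omega11 \<alpha>)) \<le> 2 / (irr_exp \<alpha> + 1)" by simp
next
  fix \<alpha> :: real assume \<alpha>: "\<alpha> \<in> {0..<1}" "\<alpha> \<notin> \<rat>"
    and lim: "1 < liminf (\<lambda>k. ereal (ln (real_of_int (cf_q \<alpha> (Suc k))) / ln (real_of_int (cf_q \<alpha> k))))"
  obtain lam where lam: "1 < ereal lam"
    "ereal lam < liminf (\<lambda>k. ereal (ln (real_of_int (cf_q \<alpha> (Suc k))) / ln (real_of_int (cf_q \<alpha> k))))"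
    using ereal_dense2[OF lim] by blast
  interpret lacunary_convergents \<alpha> lam "cf_p \<alpha>" "cf_q \<alpha>"
    using lam by (intro lacunary_convergents_cf[OF \<alpha>]) simp_all
  show "ereal (hausdorff_dim (Omega11 \<alpha>)) = 1 / (irr_exp \<alpha> + 1)"
  proof (rule antisym)
    show "ereal (hausdorff_dim (Omega11 \<alpha>)) \<le> 1 / (irr_exp \<alpha> + 1)"
      unfolding one_ereal_def[symmetric]
      by (rule hausdorff_dim_le_irr_exp[OF \<alpha>(2) zero_less_one, unfolded one_ereal_def[symmetric]])
        (rule Omega11_null_of_irr_exp)
    have ge1: "1 \<le> irr_exp \<alpha>" by (rule irr_exp_ge_1[OF \<alpha>(2)])
    \<comment> \<open>Any exponent strictly between 0 and 1 would do: it shows that the measure of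
      order 1 vanishes, so the infimum defining the dimension is over a nonempty set.\<close>
    have "ereal (1/2) < irr_exp \<alpha>" by (rule less_le_trans[OF _ ge1]) simp
    then have null: "hausdorff_measure 1 (Omega11 \<alpha>) = 0"
      by (intro Omega11_null_of_irr_exp[of "1/2"] irr_exp_infinite) auto
    show "1 / (irr_exp \<alpha> + 1) \<le> ereal (hausdorff_dim (Omega11 \<alpha>))"
    proof (cases "irr_exp \<alpha>")
      case (real w)
      then have w: "1 \<le> w" using ge1 by simp
      then have "1 / (w + 1) \<le> hausdorff_dim (Omega11 \<alpha>)"
        using real by (intro hausdorff_dim_ge[OF _ _ null] Omega11_measure_nonzero_of_irr_exp) auto
      moreover have sum: "irr_exp \<alpha> + 1 = ereal (w + 1)" using real by simp
      have "1 / (irr_exp \<alpha> + 1) = ereal 1 / ereal (w + 1)"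
        unfolding sum by (simp only: one_ereal_def)
      moreover have "ereal 1 / ereal (w + 1) = ereal (1 / (w + 1))" using w by simp
      ultimately show ?thesis by simp
    next
      case PInf
      have "0 \<le> hausdorff_dim (Omega11 \<alpha>)" by (rule hausdorff_dim_ge[OF _ _ null]) auto
      then show ?thesis using PInf by simp
    next
      case MInf
      then show ?thesis using ge1 by simp
    qed
  qed
qed

end
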